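(* Let $n\ge 2$, let $a\in\mathbb{B}^n$ and let $h:\mathbb{B}^n\to\mathbb{B}^n$ be a Möbius transformation of the unit ball onto itself with $h(a)=0$. Then for all $x,y\in\mathbb{B}^n$ $$\frac{1}{1+|a|}\,k_{\mathbb{B}^n}(x,y)\le k_{\mathbb{B}^n}\left(h(x),h(y)\right)\le (1+|a|)\,k_{\mathbb{B}^n}(x,y),$$ and the constants $1+|a|$ and $1/(1+|a|)$ are both sharp (that is, for the given $a$ and $h$, the constant $1+|a|$ cannot be replaced by a smaller one and the constant $1/(1+|a|)$ cannot be replaced by a larger one so that the inequality holds for all $x,y\in\mathbb{B}^n$).
   Context: $\mathbb{B}^n=\{x\in\mathbb{R}^n:|x|<1\}$ is the Euclidean unit ball. A Möbius transformation is a member of the group generated by reflections in hyperplanes and inversions in spheres of $\overline{\mathbb{R}^n}=\mathbb{R}^n\cup\{\infty\}$ (orientation-reversing maps are allowed). For a domain $D\subsetneq\mathbb{R}^n$ the quasihyperbolic metric is $$k_D(x,y)=\inf_{\gamma\in\Gamma}\int_\gamma\frac{1}{d(z)}\,|dz|,\quad x,y\in D,$$ where $\Gamma$ is the family of all rectifiable curves in $D$ joining $x$ and $y$, and $d(z)=d(z,\partial D)$ is the Euclidean distance from $z$ to the boundary of $D$. In particular $d(z)=1-|z|$ when $D=\mathbb{B}^n$. *)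

theory Defs
  imports "HOL-Analysis.Analysis"
begin

subsection \<open>Moebius transformations\<close>

text \<open>
  The extended space is encoded as in \<open>Alexandroff_compactification\<close>: \<open>Some x\<close> is the finite
  point \<open>x\<close> and \<open>None\<close> is the point at infinity.
\<close>

text \<open>Reflection in the hyperplane \<open>{x. u \<bullet> x = t}\<close>, for \<open>u \<noteq> 0\<close>.\<close>

definition hyperplane_reflection ::
  "'a::euclidean_space \<Rightarrow> real \<Rightarrow> 'a option \<Rightarrow> 'a option" where
  "hyperplane_reflection u t p =
     (case p of None \<Rightarrow> None
      | Some x \<Rightarrow> Some (x - (2 * (u \<bullet> x - t) / (norm u)\<^sup>2) *\<^sub>R u))"

text \<open>Inversion in \<open>sphere c r\<close>, for \<open>r > 0\<close>.\<close>

definition sphere_inversion ::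
  "'a::euclidean_space \<Rightarrow> real \<Rightarrow> 'a option \<Rightarrow> 'a option" where
  "sphere_inversion c r p =
     (case p of None \<Rightarrow> Some c
      | Some x \<Rightarrow> if x = c then None else Some (c + (r\<^sup>2 / (norm (x - c))\<^sup>2) *\<^sub>R (x - c)))"

inductive_set moebius_group :: "('a::euclidean_space option \<Rightarrow> 'a option) set" where
  identity: "id \<in> moebius_group"
| reflection: "u \<noteq> 0 \<Longrightarrow> hyperplane_reflection u t \<in> moebius_group"
| inversion: "r > 0 \<Longrightarrow> sphere_inversion c r \<in> moebius_group"
| composition: "f \<in> moebius_group \<Longrightarrow> g \<in> moebius_group \<Longrightarrow> f \<circ> g \<in> moebius_group"
| inverse: "f \<in> moebius_group \<Longrightarrow> inv f \<in> moebius_group"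

text \<open>
  The restriction to \<open>D\<close> of some Moebius transformation, mapping \<open>D\<close> onto itself. Values of \<open>h\<close>
  outside \<open>D\<close> are irrelevant.
\<close>

definition moebius_self_map :: "'a::euclidean_space set \<Rightarrow> ('a \<Rightarrow> 'a) \<Rightarrow> bool" where
  "moebius_self_map D h \<longleftrightarrow>
     h ` D = D \<and> (\<exists>F\<in>moebius_group. \<forall>x\<in>D. F (Some x) = Some (h x))"


subsection \<open>Rectifiable curves and integration with respect to arc length\<close>

text \<open>Lengths of the polygons inscribed in \<open>g\<close> restricted to \<open>{0..t}\<close>.\<close>

definition inscribed_lengths :: "(real \<Rightarrow> 'a::metric_space) \<Rightarrow> real \<Rightarrow> real set" where
  "inscribed_lengths g t =
     {(\<Sum>i<m. dist (g (p i)) (g (p (Suc i)))) | (p :: nat \<Rightarrow> real) m.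
        mono p \<and> p 0 = 0 \<and> p m = t}"

definition rectifiable_path :: "(real \<Rightarrow> 'a::metric_space) \<Rightarrow> bool" where
  "rectifiable_path g \<longleftrightarrow> path g \<and> bdd_above (inscribed_lengths g 1)"

text \<open>The length of \<open>g\<close> restricted to \<open>{0..t}\<close>; meaningful for rectifiable \<open>g\<close> and \<open>t \<in> {0..1}\<close>.\<close>

definition arc_length :: "(real \<Rightarrow> 'a::metric_space) \<Rightarrow> real \<Rightarrow> real" where
  "arc_length g t = Sup (inscribed_lengths g t)"

text \<open>
  For rectifiable \<open>g\<close>, \<open>arc_length g\<close> maps \<open>{0..1}\<close> continuously onto \<open>{0..arc_length g 1}\<close>, and
  \<open>g\<close> is constant on each of its fibres, so the point below does not depend on the choice of \<open>t\<close>.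
\<close>

definition arc_length_param :: "(real \<Rightarrow> 'a::metric_space) \<Rightarrow> real \<Rightarrow> 'a" where
  "arc_length_param g s = g (SOME t. t \<in> {0..1} \<and> arc_length g t = s)"

definition arc_length_integral :: "(real \<Rightarrow> 'a::metric_space) \<Rightarrow> ('a \<Rightarrow> real) \<Rightarrow> real" where
  "arc_length_integral g \<rho> = integral {0..arc_length g 1} (\<lambda>s. \<rho> (arc_length_param g s))"


subsection \<open>The quasihyperbolic metric\<close>

text \<open>
  Intended for a domain \<open>D \<noteq> UNIV\<close>: then the boundary is nonempty, any two points of \<open>D\<close> are
  joined by a rectifiable path in \<open>D\<close>, and the infimum is over a nonempty set of nonnegative reals.
\<close>

definition quasihyperbolic_dist :: "'a::euclidean_space set \<Rightarrow> 'a \<Rightarrow> 'a \<Rightarrow> real" where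
  "quasihyperbolic_dist D x y =
     Inf {arc_length_integral g (\<lambda>z. 1 / infdist z (frontier D)) | g.
            rectifiable_path g \<and> path_image g \<subseteq> D \<and> pathstart g = x \<and> pathfinish g = y}"

end

theory Submission
  imports Defs
begin

text \<open>
  A Moebius transformation multiplies squared distances \<open>|x - y|\<^sup>2\<close> by a product \<open>m(x) m(y)\<close>. After
  composition with the inversion that exchanges \<open>0\<close> and \<open>a\<close>, a self-map \<open>h\<close> of the unit ball fixes the
  origin, and letting points tend to the boundary shows that it is then an isometry. Hence \<open>h\<close>
  preserves \<open>|x - y|\<^sup>2 / ((1 - |x|\<^sup>2) (1 - |y|\<^sup>2))\<close>. So its local dilation at \<open>z\<close> is
  \<open>(1 - |h z|\<^sup>2) / (1 - |z|\<^sup>2)\<close>, and it changes the quasihyperbolic line element by the factor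
  \<open>(1 + |h z|) / (1 + |z|)\<close>. The bound \<open>|h z| \<le> (|z| + |a|) / (1 + |z| |a|)\<close> gives at most
  \<open>1 + |a|\<close>, with equality at \<open>z = 0\<close>; near the origin, in the direction of \<open>-a\<close>, the constant is
  therefore sharp. The lower estimate is the upper one for the inverse of \<open>h\<close>, which maps \<open>h 0\<close>
  to \<open>0\<close>, where \<open>|h 0| = |a|\<close>.
\<close>

text \<open>Two obstacles shape the proof. The distance identity is exploited on the open ball, with
  a positive factor of unknown regularity; continuity of \<open>h\<close> and of its inverse, and
  the behaviour near the unit sphere, are extracted from it and from the boundedness of the ball.
  Moreover the curves are merely rectifiable: instead of line elements at a point, the proof
  compares increments over short parameter intervals, accepts an arbitrarily small loss in the
  constant, and joins the intervals by bisection. This one comparison principle serves both for the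
  image of a curve under \<open>h\<close> and for a logarithmic lower bound of the distance.
  Sharpness is a first-order matter: for points at distance \<open>t\<close> from the origin, that
  lower bound for the images and the length of a segment for the points themselves have a ratio that
  tends to \<open>1 + norm a\<close>.\<close>

subsection \<open>Moebius self-maps of the ball\<close>

text \<open>
  The junk values at infinity are chosen so that every Moebius transformation \<open>F\<close> satisfies
  \<open>ext_sqdist (F p) (F q) = m p * m q * ext_sqdist p q\<close> with one positive function \<open>m\<close>.
\<close>

definition ext_sqdist :: "'a::euclidean_space option \<Rightarrow> 'a option \<Rightarrow> real" where
  "ext_sqdist p q = (case p of None \<Rightarrow> (case q of None \<Rightarrow> 0 | Some y \<Rightarrow> 1)
     | Some x \<Rightarrow> (case q of None \<Rightarrow> 1 | Some y \<Rightarrow> (norm (x - y))\<^sup>2))"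

lemma ext_sqdist_simps [simp]:
  "ext_sqdist None None = 0" "ext_sqdist (Some x) None = 1" "ext_sqdist None (Some x) = 1"
  "ext_sqdist (Some x) (Some y) = (norm (x - y))\<^sup>2"
  by (simp_all add: ext_sqdist_def)

lemma norm_diff_scaleR_sq:
  fixes u v :: "'a::real_inner"
  shows "(norm (a *\<^sub>R u - b *\<^sub>R v))\<^sup>2 = a\<^sup>2 * (u \<bullet> u) - 2 * a * b * (u \<bullet> v) + b\<^sup>2 * (v \<bullet> v)"
  unfolding power2_norm_eq_inner inner_diff_left inner_diff_right
  by (simp add: inner_commute [of v u] algebra_simps power2_eq_square)

text \<open>With \<open>u = x - c\<close> and \<open>v = y - c\<close>, both sides expand to
  \<open>r^2 * (1/|u|^2 - 2 (u \<bullet> v) / (|u|^2 |v|^2) + 1/|v|^2)\<close>. Here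
  \<open>r\<close> stands for the squared radius.\<close>

lemma inversion_dist:
  fixes c x y :: "'a::real_inner"
  assumes "x \<noteq> c" "y \<noteq> c"
  shows "(norm ((r / (norm (x - c))\<^sup>2) *\<^sub>R (x - c) - (r / (norm (y - c))\<^sup>2) *\<^sub>R (y - c)))\<^sup>2
    = (r / (norm (x - c))\<^sup>2) * (r / (norm (y - c))\<^sup>2) * (norm (x - y))\<^sup>2"
proof -
  define u v where "u = x - c" and "v = y - c"
  define A B C where "A = u \<bullet> u" and "B = v \<bullet> v" and "C = u \<bullet> v"
  have nz: "A \<noteq> 0" "B \<noteq> 0" using assms by (auto simp: u_def v_def A_def B_def)
  have "(norm (x - y))\<^sup>2 = A - 2 * C + B"
    using norm_diff_scaleR_sq [of 1 u 1 v] by (simp add: u_def v_def A_def B_def C_def)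
  moreover have "(r / A)\<^sup>2 * A - 2 * (r / A) * (r / B) * C + (r / B)\<^sup>2 * B
      = (r / A) * (r / B) * (A - 2 * C + B)"
    using nz by (simp add: field_simps power2_eq_square)
  ultimately show ?thesis
    unfolding u_def [symmetric] v_def [symmetric] norm_diff_scaleR_sq power2_norm_eq_inner [of u]
      power2_norm_eq_inner [of v] A_def [symmetric] B_def [symmetric] C_def [symmetric] by simp
qed

lemma reflection_dist:
  fixes u x y :: "'a::real_inner"
  assumes "u \<noteq> 0"
  shows "norm ((x - (2 * (u \<bullet> x - t) / (norm u)\<^sup>2) *\<^sub>R u) - (y - (2 * (u \<bullet> y - t) / (norm u)\<^sup>2) *\<^sub>R u))
    = norm (x - y)"
proof -
  define w where "w = x - y"
  have nz: "u \<bullet> u \<noteq> 0" using assms by auto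
  have "2 * (u \<bullet> x - t) / (norm u)\<^sup>2 - 2 * (u \<bullet> y - t) / (norm u)\<^sup>2 = 2 * (u \<bullet> w) / (norm u)\<^sup>2"
    by (simp add: w_def inner_diff_right diff_divide_distrib right_diff_distrib)
  moreover have "(x - k *\<^sub>R u) - (y - l *\<^sub>R u) = w - (k - l) *\<^sub>R u" for k l
    by (simp add: w_def scaleR_diff_left)
  ultimately have "(x - (2 * (u \<bullet> x - t) / (norm u)\<^sup>2) *\<^sub>R u) - (y - (2 * (u \<bullet> y - t) / (norm u)\<^sup>2) *\<^sub>R u)
     = w - (2 * (u \<bullet> w) / (norm u)\<^sup>2) *\<^sub>R u"
    by (simp only:)
  moreover have "(norm (w - (2 * (u \<bullet> w) / (norm u)\<^sup>2) *\<^sub>R u))\<^sup>2 = (norm w)\<^sup>2"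
    using nz norm_diff_scaleR_sq [of 1 w "2 * (u \<bullet> w) / (norm u)\<^sup>2" u]
    unfolding power2_norm_eq_inner [of u] power2_norm_eq_inner [of w]
    by (simp add: inner_commute [of w u] field_simps power2_eq_square)
  ultimately have "(norm ((x - (2 * (u \<bullet> x - t) / (norm u)\<^sup>2) *\<^sub>R u)
      - (y - (2 * (u \<bullet> y - t) / (norm u)\<^sup>2) *\<^sub>R u)))\<^sup>2 = (norm w)\<^sup>2"
    by (simp only:)
  then show ?thesis unfolding w_def by (simp only: power2_eq_iff_nonneg norm_ge_zero)
qed

lemma hyperplane_reflection_involution:
  assumes "u \<noteq> 0"
  shows "hyperplane_reflection u t (hyperplane_reflection u t p) = p"
proof (cases p)
  case (Some x)
  define k where "k = 2 * (u \<bullet> x - t) / (norm u)\<^sup>2"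
  have nz: "u \<bullet> u \<noteq> 0" using assms by auto
  have "2 * (u \<bullet> (x - k *\<^sub>R u) - t) / (norm u)\<^sup>2 = - k"
    using nz by (simp add: k_def power2_norm_eq_inner inner_diff_right field_simps)
  moreover have "hyperplane_reflection u t (Some z) = Some (z - (2 * (u \<bullet> z - t) / (norm u)\<^sup>2) *\<^sub>R u)" for z
    by (simp add: hyperplane_reflection_def)
  ultimately show ?thesis
    unfolding Some by (simp only: flip: k_def) simp
qed (simp add: hyperplane_reflection_def)

lemma sphere_inversion_involution:
  assumes "r > 0"
  shows "sphere_inversion c r (sphere_inversion c r p) = p"
proof (cases p)
  case (Some x)
  show ?thesis
  proof (cases "x = c")
    case False
    define k where "k = r\<^sup>2 / (norm (x - c))\<^sup>2"
    have k: "k > 0" using False assms by (simp add: k_def)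
    have "r\<^sup>2 / (norm (k *\<^sub>R (x - c)))\<^sup>2 * k = 1"
      using False assms by (simp add: k_def power_mult_distrib power_divide power2_eq_square)
    then show ?thesis using k False assms
      by (simp add: Some sphere_inversion_def flip: k_def)
  qed (simp add: Some sphere_inversion_def)
qed (simp add: sphere_inversion_def)

text \<open>The identity is multiplicative, so it passes to compositions and inverses. Bijectivity
  belongs to the induction because the inverse case substitutes \<open>inv f p\<close> for
  \<open>p\<close> and needs \<open>f (inv f p) = p\<close>.\<close>

lemma moebius_group_distortion:
  assumes "F \<in> moebius_group"
  shows "bij F \<and> (\<exists>m. (\<forall>p. m p > 0) \<and>
    (\<forall>p q. ext_sqdist (F p) (F q) = m p * m q * ext_sqdist p q))"
  using assms
proof induction
  case identity
  show ?case by (auto intro!: exI [of _ "\<lambda>_. 1"] simp: bij_id [unfolded id_def])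
next
  case (reflection u t)
  have "ext_sqdist (hyperplane_reflection u t p) (hyperplane_reflection u t q) = ext_sqdist p q" for p q
    using reflection_dist [OF reflection] 
    by (auto simp: hyperplane_reflection_def split: option.split)
  then show ?case
    using hyperplane_reflection_involution [OF reflection]
    by (auto intro!: exI [of _ "\<lambda>_. 1"] involuntory_imp_bij)
next
  case (inversion r c)
  \<comment> \<open>The exceptional values are forced: the pair \<open>None\<close>,
    \<open>Some x\<close> requires \<open>r^4 / |x - c|^2 = m None * m (Some x)\<close>, and the
    pair \<open>Some c\<close>, \<open>Some x\<close> requires
    \<open>1 = m (Some c) * r^2\<close>.\<close>
  define m where "m p = (case p of None \<Rightarrow> r\<^sup>2
      | Some x \<Rightarrow> if x = c then 1 / r\<^sup>2 else r\<^sup>2 / (norm (x - c))\<^sup>2)" for p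
  have pos: "m p > 0" for p
    using inversion by (auto simp: m_def split: option.split)
  have eq: "ext_sqdist (sphere_inversion c r p) (sphere_inversion c r q) = m p * m q * ext_sqdist p q" for p q
  proof (cases p; cases q)
    fix x y assume pq: "p = Some x" "q = Some y"
    show ?thesis
    proof (cases "x = c \<or> y = c")
      case True
      then show ?thesis using inversion pq
        by (auto simp: sphere_inversion_def m_def norm_minus_commute)
    next
      case False
      then show ?thesis using pq inversion_dist [of x c y "r\<^sup>2"]
        by (simp add: sphere_inversion_def m_def)
    qed
  qed (use inversion in \<open>auto simp: sphere_inversion_def m_def power_divide power_mult_distrib power2_eq_square\<close>)
  show ?case
    using pos eq sphere_inversion_involution [OF inversion]
    by (auto intro!: involuntory_imp_bij)
next
  case (composition f g)
  then obtain m1 m2 where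
    "\<forall>p. m1 p > 0" "\<forall>p q. ext_sqdist (f p) (f q) = m1 p * m1 q * ext_sqdist p q"
    "\<forall>p. m2 p > 0" "\<forall>p q. ext_sqdist (g p) (g q) = m2 p * m2 q * ext_sqdist p q" by blast
  then have "\<exists>m. (\<forall>p. m p > 0) \<and> (\<forall>p q. ext_sqdist ((f \<circ> g) p) ((f \<circ> g) q) = m p * m q * ext_sqdist p q)"
    by (intro exI [of _ "\<lambda>p. m1 (g p) * m2 p"]) (simp add: mult_ac)
  then show ?case using composition.IH bij_comp [of g f] by blast
next
  case (inverse f)
  then obtain m where m: "bij f"
    "\<forall>p. m p > 0" "\<forall>p q. ext_sqdist (f p) (f q) = m p * m q * ext_sqdist p q" by blast
  have eq: "ext_sqdist (inv f p) (inv f q) = 1 / m (inv f p) * (1 / m (inv f q)) * ext_sqdist p q" for p q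
  proof -
    have "ext_sqdist p q = m (inv f p) * m (inv f q) * ext_sqdist (inv f p) (inv f q)"
      using m(1) m(3)[rule_format, of "inv f p" "inv f q"] by (simp add: bij_is_surj surj_f_inv_f)
    moreover have "m (inv f p) \<noteq> 0" "m (inv f q) \<noteq> 0" using m(2) by (metis less_irrefl)+
    ultimately show ?thesis by simp
  qed
  have "\<exists>m'. (\<forall>p. m' p > 0) \<and> (\<forall>p q. ext_sqdist (inv f p) (inv f q) = m' p * m' q * ext_sqdist p q)"
    by (rule exI [of _ "\<lambda>p. 1 / m (inv f p)"]) (use m(2) eq in auto)
  then show ?case using m(1) by (simp add: bij_imp_bij_inv)
qed

section \<open>Self-maps of the ball with a conformal factor\<close>

text \<open>Where \<open>m\<close> is continuous, letting \<open>y\<close> tend to \<open>x\<close>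
  shows that \<open>m x\<close> is the local dilation of \<open>h\<close> at \<open>x\<close>. From
  here on, this property represents the Moebius maps.\<close>

definition conformal_factor :: "('a::real_normed_vector \<Rightarrow> 'a) \<Rightarrow> ('a \<Rightarrow> real) \<Rightarrow> bool" where
  "conformal_factor h m \<longleftrightarrow> (\<forall>x\<in>ball 0 1. m x > 0) \<and>
     (\<forall>x\<in>ball 0 1. \<forall>y\<in>ball 0 1. (norm (h x - h y))\<^sup>2 = m x * m y * (norm (x - y))\<^sup>2)"

lemma moebius_self_map_distortion:
  assumes "moebius_self_map (ball 0 1) h"
  shows "bij_betw h (ball 0 1) (ball 0 1)" "\<exists>m. conformal_factor h m"
proof -
  obtain F where F: "h ` ball 0 1 = ball 0 1" "F \<in> moebius_group" "\<And>x. x \<in> ball 0 1 \<Longrightarrow> F (Some x) = Some (h x)"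
    using assms by (auto simp: moebius_self_map_def)
  obtain m where m: "bij F" "\<And>p. m p > 0" "\<And>p q. ext_sqdist (F p) (F q) = m p * m q * ext_sqdist p q"
    using moebius_group_distortion [OF F(2)] by blast
  have "inj_on h (ball 0 1)"
  proof (rule inj_onI)
    fix x y assume *: "x \<in> ball 0 1" "y \<in> ball 0 1" "h x = h y"
    then have "F (Some x) = F (Some y)" using F(3)[of x] F(3)[of y] by simp
    then show "x = y" using m(1) by (simp add: bij_is_inj inj_eq)
  qed
  then show "bij_betw h (ball 0 1) (ball 0 1)" using F(1) by (simp add: bij_betw_def)
  have "conformal_factor h (\<lambda>x. m (Some x))"
    unfolding conformal_factor_def
  proof (intro conjI ballI)
    fix x y :: 'a assume "x \<in> ball 0 1" "y \<in> ball 0 1"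
    then show "(norm (h x - h y))\<^sup>2 = m (Some x) * m (Some y) * (norm (x - y))\<^sup>2"
      using m(3) [of "Some x" "Some y"] F(3)[of x] F(3)[of y] by simp
  qed (use m in auto)
  then show "\<exists>m. conformal_factor h m" by blast
qed

lemma conformal_factorD:
  assumes "conformal_factor h m"
  shows "x \<in> ball 0 1 \<Longrightarrow> m x > 0"
    "x \<in> ball 0 1 \<Longrightarrow> y \<in> ball 0 1 \<Longrightarrow> (norm (h x - h y))\<^sup>2 = m x * m y * (norm (x - y))\<^sup>2"
  using assms by (auto simp: conformal_factor_def)

lemma conformal_factor_inv:
  assumes "bij_betw h (ball 0 1) (ball 0 1)" "conformal_factor h m"
  shows "conformal_factor (inv_into (ball 0 1) h) (\<lambda>y. 1 / m (inv_into (ball 0 1) h y))"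
proof -
  define k where "k = inv_into (ball 0 1) h"
  have k: "k y \<in> ball 0 1" "h (k y) = y" if "y \<in> ball 0 1" for y
    using assms(1) that bij_betw_inv_into [OF assms(1)]
    by (auto simp: k_def bij_betw_def intro: f_inv_into_f) 
  have "conformal_factor k (\<lambda>y. 1 / m (k y))"
    unfolding conformal_factor_def
  proof (intro conjI ballI)
    fix x y :: 'a assume *: "x \<in> ball 0 1" "y \<in> ball 0 1"
    then have "m (k x) > 0" "m (k y) > 0" using conformal_factorD(1) [OF assms(2)] k by auto
    moreover have "(norm (x - y))\<^sup>2 = m (k x) * m (k y) * (norm (k x - k y))\<^sup>2"
      using conformal_factorD(2) [OF assms(2), of "k x" "k y"] k * by simp
    ultimately show "(norm (k x - k y))\<^sup>2 = 1 / m (k x) * (1 / m (k y)) * (norm (x - y))\<^sup>2"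
      by simp
  qed (use conformal_factorD(1) [OF assms(2)] k in auto)
  then show ?thesis by (simp add: k_def)
qed

lemma conformal_factor_comp:
  assumes "conformal_factor f m" "conformal_factor g l" "g ` ball 0 1 \<subseteq> ball 0 1"
  shows "conformal_factor (f \<circ> g) (\<lambda>x. m (g x) * l x)"
proof -
  have g: "g x \<in> ball 0 1" if "x \<in> ball 0 1" for x using assms(3) that by blast
  show ?thesis
    unfolding conformal_factor_def
  proof (intro conjI ballI)
    fix x y :: 'a assume *: "x \<in> ball 0 1" "y \<in> ball 0 1"
    show "(norm ((f \<circ> g) x - (f \<circ> g) y))\<^sup>2 = m (g x) * l x * (m (g y) * l y) * (norm (x - y))\<^sup>2"
      using conformal_factorD(2) [OF assms(1) g g, OF *] conformal_factorD(2) [OF assms(2) *] by simp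
  qed (use conformal_factorD(1) [OF assms(1)] conformal_factorD(1) [OF assms(2)] g in auto)
qed

text \<open>The point is a local bound for \<open>m\<close>. For a reference point \<open>z\<close>,
  the images of \<open>x\<close> and \<open>z\<close> are at most 2 apart, so
  \<open>m x * m z * |x - z|^2 \<le> 4\<close>; this bounds \<open>m x\<close> as long as
  \<open>x\<close> stays away from \<open>z\<close>.\<close>

lemma conformal_factor_continuous:
  fixes h :: "'a::euclidean_space \<Rightarrow> 'a"
  assumes "h ` ball 0 1 \<subseteq> ball 0 1" "conformal_factor h m"
  shows "continuous_on (ball 0 1) h"
proof (rule continuous_at_imp_continuous_on, rule ballI)
  fix x0 :: 'a assume x0: "x0 \<in> ball 0 1"
  note m = conformal_factorD [OF assms(2)]
  obtain e :: 'a where e: "norm e = 1" by (metis vector_choose_size zero_le_one)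
  \<comment> \<open>Any point of the ball other than \<open>x0\<close> would do; this choice has
    norm \<open>1/2\<close> when \<open>x0\<close> is closer to the origin than that, and is the
    origin otherwise. Half the distance to it is the margin \<open>d\<close>.\<close>
  define z where "z = (if norm x0 < 1/2 then (1/2) *\<^sub>R e else 0)"
  have z: "z \<in> ball 0 1" "z \<noteq> x0" using e by (auto simp: z_def)
  define d where "d = norm (x0 - z) / 2"
  have d: "d > 0" using z by (simp add: d_def)
  define K where "K = 4 / (m z * d\<^sup>2) * m x0"
  have ev: "\<forall>\<^sub>F x in at x0. norm (h x - h x0) \<le> sqrt K * norm (x - x0)"
  proof -
    have "\<forall>\<^sub>F x in at x0. x \<in> ball 0 1 \<inter> ball x0 d"
      using x0 d by (intro eventually_at_topological [THEN iffD2] exI [of _ "ball 0 1 \<inter> ball x0 d"]) auto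
    then show ?thesis
    proof eventually_elim
      case (elim x)
      have "norm (x0 - z) \<le> norm (x0 - x) + norm (x - z)" by (metis norm_triangle_ineq diff_add_cancel add_diff_eq)
      moreover have "norm (x0 - x) < d" using elim by (simp add: dist_norm)
      ultimately have 1: "d \<le> norm (x - z)" by (simp add: d_def)
      have "norm (h x) < 1" "norm (h z) < 1" using assms(1) elim z by (auto simp: image_subset_iff)
      then have "norm (h x - h z) \<le> 2" using norm_triangle_ineq4 [of "h x" "h z"] by linarith
      then have "(norm (h x - h z))\<^sup>2 \<le> 4" using power_mono [of "norm (h x - h z)" 2 2] by simp
      then have "m x * m z * (norm (x - z))\<^sup>2 \<le> 4" using m(2) [of x z] elim z by simp
      moreover have "m x * m z * d\<^sup>2 \<le> m x * m z * (norm (x - z))\<^sup>2"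
        using 1 d m(1)[of x] m(1)[of z] elim z by (intro mult_left_mono power_mono) auto
      ultimately have "m x * (m z * d\<^sup>2) \<le> 4" by (simp add: mult_ac)
      then have "m x \<le> 4 / (m z * d\<^sup>2)" using d m(1)[of z] z by (simp add: field_simps)
      then have "m x * m x0 \<le> K" unfolding K_def using m(1)[of x0] x0 by (intro mult_right_mono) auto
      then have "(norm (h x - h x0))\<^sup>2 \<le> K * (norm (x - x0))\<^sup>2"
        using m(2) [of x x0] elim x0 by (simp add: mult_right_mono)
      then have "sqrt ((norm (h x - h x0))\<^sup>2) \<le> sqrt (K * (norm (x - x0))\<^sup>2)" by (rule real_sqrt_le_mono)
      then show ?case by (simp add: real_sqrt_mult)
    qed
  qed
  have "((\<lambda>x. sqrt K * norm (x - x0)) \<longlongrightarrow> sqrt K * norm (x0 - x0)) (at x0)"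
    by (intro tendsto_intros)
  then have "((\<lambda>x. h x - h x0) \<longlongrightarrow> 0) (at x0)"
    by (intro Lim_null_comparison [OF ev]) simp
  then show "isCont h x0" by (simp add: isCont_def LIM_zero_iff)
qed

text \<open>The inverse is continuous, hence maps \<open>cball 0 r\<close> to a compact subset of
  the open ball, and \<open>s\<close> is the largest norm there. This replaces boundary values of
  \<open>h\<close>.\<close>

lemma conformal_factor_proper:
  fixes h :: "'a::euclidean_space \<Rightarrow> 'a"
  assumes "bij_betw h (ball 0 1) (ball 0 1)" "conformal_factor h m" "r < 1"
  obtains s where "0 \<le> s" "s < 1" "\<And>y. y \<in> ball 0 1 \<Longrightarrow> s < norm y \<Longrightarrow> r < norm (h y)"
proof (cases "r < 0")
  case True
  then have "r < norm (h y)" for y by (metis norm_ge_zero order_less_le_trans)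
  then show ?thesis using that[of 0] by simp
next
  case False
  define k where "k = inv_into (ball 0 1) h"
  have bk: "bij_betw k (ball 0 1) (ball 0 1)" unfolding k_def by (rule bij_betw_inv_into [OF assms(1)])
  have sub: "cball 0 r \<subseteq> ball 0 (1::real)" "cball 0 r \<subseteq> ball (0::'a) 1" using assms(3) by auto
  have "continuous_on (ball 0 1) k"
    using conformal_factor_continuous [OF _ conformal_factor_inv [OF assms(1,2)]] bk
    by (simp add: k_def bij_betw_def)
  then have "compact (k ` cball 0 r)"
    using sub by (intro compact_continuous_image) (auto intro: continuous_on_subset)
  moreover have "k ` cball 0 r \<noteq> {}" using False by simp
  ultimately obtain w where w: "w \<in> k ` cball 0 r" "\<And>v. v \<in> k ` cball 0 r \<Longrightarrow> norm v \<le> norm w"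
    using continuous_attains_sup [of "k ` cball 0 r" norm] by (auto intro: continuous_intros)
  show ?thesis
  proof (rule that [of "norm w"])
    have "k ` cball 0 r \<subseteq> ball 0 1" using bk sub(2) by (auto simp: bij_betw_def)
    then show "norm w < 1" using w(1) by auto
    fix y :: 'a assume y: "y \<in> ball 0 1" "norm w < norm y"
    show "r < norm (h y)"
    proof (rule ccontr)
      assume "\<not> r < norm (h y)"
      then have "k (h y) \<in> k ` cball 0 r" by simp
      moreover have "k (h y) = y" unfolding k_def by (rule bij_betw_inv_into_left [OF assms(1) y(1)])
      ultimately show False using w(2)[of y] y(2) by simp
    qed
  qed simp
qed

text \<open>
  Compare \<open>x\<close> with points \<open>y\<close> that tend to the ends of the diameter through \<open>x\<close>; since \<open>h\<close> is proper,
  \<open>norm (h y)\<close> tends to \<open>1\<close>. Both inequalities for \<open>h\<close> and for its inverse become equalities.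
\<close>

lemma origin_fixing_norm_bounds:
  fixes h :: "'a::euclidean_space \<Rightarrow> 'a"
  assumes "bij_betw h (ball 0 1) (ball 0 1)" "conformal_factor h m" "h 0 = 0"
    and x: "x \<in> ball 0 1" "x \<noteq> 0"
  shows "norm (h x) * (1 + norm x) \<le> (1 + norm (h x)) * (m 0 * norm x)"
    and "(1 - norm (h x)) * (m 0 * norm x) \<le> norm (h x) * (1 - norm x)"
proof -
  note m = conformal_factorD [OF assms(2)]
  have m0: "m 0 > 0" using m(1) by simp
  \<comment> \<open>Pairing \<open>x\<close> and \<open>y\<close> with the fixed point 0 eliminates
    \<open>m x\<close> and \<open>m y\<close>; only the constant \<open>m 0\<close>
    survives.\<close>
  have rel: "norm (h x - h y) * (m 0 * norm x) * norm y = norm (h x) * norm (h y) * norm (x - y)"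
    if y: "y \<in> ball 0 1" for y
  proof -
    have "(norm (h x))\<^sup>2 = m x * m 0 * (norm x)\<^sup>2" "(norm (h y))\<^sup>2 = m y * m 0 * (norm y)\<^sup>2"
      using m(2)[of x 0] m(2)[of y 0] x y assms(3) by auto
    then have "(norm (h x - h y) * (m 0 * norm x) * norm y)\<^sup>2 = (norm (h x) * norm (h y) * norm (x - y))\<^sup>2"
      using m(2)[of x y] x y by (simp only: power_mult_distrib mem_ball_0) (simp add: power2_eq_square)
    then show ?thesis using m0 by (subst (asm) power2_eq_iff_nonneg) auto
  qed
  have hx: "norm (h x) > 0"
  proof -
    have "(norm (h x))\<^sup>2 = m x * m 0 * (norm x)\<^sup>2" using m(2)[of x 0] x assms(3) by auto
    then show ?thesis using m0 m(1)[of x] x by auto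
  qed
  \<comment> \<open>Here \<open>r\<close> is a lower bound for \<open>norm (h y)\<close> at the two
    points \<open>y\<close> of norm \<open>t\<close> on the diameter through \<open>x\<close>; at
    the end \<open>r\<close> tends to 1. The antipodal point yields the first estimate, the point on
    the side of \<open>x\<close> the second.\<close>
  have dense: "norm (h x) * r * (norm x + r) \<le> (1 + norm (h x)) * (m 0 * norm x)"
    "(r - norm (h x)) * (m 0 * norm x) * r \<le> norm (h x) * (1 - norm x)" if r: "norm (h x) < r" "0 < r" "r < 1" for r
  proof -
    obtain s where s: "0 \<le> s" "s < 1" "\<And>y. y \<in> ball 0 1 \<Longrightarrow> s < norm y \<Longrightarrow> r < norm (h y)"
      using conformal_factor_proper [OF assms(1,2) r(3)] by blast
    obtain t where t: "max (max s r) (norm x) < t" "t < 1" using dense [of "max (max s r) (norm x)" 1] s r x by auto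
    define e where "e = x /\<^sub>R norm x"
    have e: "norm e = 1" "x = norm x *\<^sub>R e" using x by (auto simp: e_def)
    have t0: "t > 0" using t s by auto
    have yb: "t *\<^sub>R e \<in> ball 0 1" "- (t *\<^sub>R e) \<in> ball 0 1" using e t t0 by auto
    have y: "r < norm (h (t *\<^sub>R e))" "r < norm (h (- (t *\<^sub>R e)))" using s(3)[OF yb(1)] s(3)[OF yb(2)] e t t0 by auto
    have y1: "norm (h (t *\<^sub>R e)) < 1" "norm (h (- (t *\<^sub>R e))) < 1"
      using assms(1) yb by (auto simp: bij_betw_def)
    have "x + t *\<^sub>R e = (norm x + t) *\<^sub>R e" using e(2) by (metis scaleR_add_left)
    then have d1: "norm (x - (- (t *\<^sub>R e))) = norm x + t" using e(1) t0 by simp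
    have "x - t *\<^sub>R e = (norm x - t) *\<^sub>R e" using e(2) by (metis scaleR_diff_left)
    then have d2: "norm (x - t *\<^sub>R e) = t - norm x" using e(1) t by simp
    have "norm (h x) * r * (norm x + r) \<le> norm (h x) * norm (h (- (t *\<^sub>R e))) * (norm x + t)"
      using hx y t r by (intro mult_mono) auto
    also have "\<dots> = norm (h x - h (- (t *\<^sub>R e))) * (m 0 * norm x) * t"
      using rel [OF yb(2)] d1 e(1) t0 by simp
    also have "\<dots> \<le> (1 + norm (h x)) * (m 0 * norm x) * 1"
      using norm_triangle_ineq4 [of "h x" "h (- (t *\<^sub>R e))"] y1 m0 t t0 by (intro mult_mono) auto
    finally show "norm (h x) * r * (norm x + r) \<le> (1 + norm (h x)) * (m 0 * norm x)" by simp
    have "r - norm (h x) \<le> norm (h x - h (t *\<^sub>R e))"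
      using norm_triangle_ineq2 [of "h (t *\<^sub>R e)" "h x"] y by (simp add: norm_minus_commute)
    then have "(r - norm (h x)) * (m 0 * norm x) * r \<le> norm (h x - h (t *\<^sub>R e)) * (m 0 * norm x) * t"
      using m0 t r by (intro mult_mono) auto
    also have "\<dots> = norm (h x) * norm (h (t *\<^sub>R e)) * (t - norm x)"
      using rel [OF yb(1)] d2 e(1) t0 by simp
    also have "\<dots> \<le> norm (h x) * 1 * (1 - norm x)"
      using y1 t by (intro mult_mono) auto
    finally show "(r - norm (h x)) * (m 0 * norm x) * r \<le> norm (h x) * (1 - norm x)" by simp
  qed
  have hx1: "norm (h x) < 1" using assms(1) x by (auto simp: bij_betw_def)
  have ev: "\<forall>\<^sub>F r in at_left 1. norm (h x) < r \<and> 0 < r \<and> r < 1"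
    using hx1 hx by (auto intro!: eventually_at_leftI [of "norm (h x)"] intro: order.strict_trans1 [OF norm_ge_zero])
  have l1: "((\<lambda>r. norm (h x) * r * (norm x + r)) \<longlongrightarrow> norm (h x) * 1 * (norm x + 1)) (at_left 1)"
    by (intro tendsto_intros)
  show "norm (h x) * (1 + norm x) \<le> (1 + norm (h x)) * (m 0 * norm x)"
    using tendsto_upperbound [OF l1 eventually_mono [OF ev]] dense(1) by (simp add: add_ac)
  have l2: "((\<lambda>r. (r - norm (h x)) * (m 0 * norm x) * r) \<longlongrightarrow> (1 - norm (h x)) * (m 0 * norm x) * 1) (at_left 1)"
    by (intro tendsto_intros)
  show "(1 - norm (h x)) * (m 0 * norm x) \<le> norm (h x) * (1 - norm x)"
    using tendsto_upperbound [OF l2 eventually_mono [OF ev]] dense(2) by simp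
qed

text \<open>Passing to the inverse swaps \<open>norm x\<close> with \<open>norm (h x)\<close> and
  replaces \<open>m 0\<close> by its reciprocal, which reverses both norm bounds. The resulting
  equalities force \<open>m 0 = 1\<close>, and comparison with the origin then gives
  \<open>m = 1\<close> on the whole ball.\<close>

lemma origin_fixing_isometry:
  fixes h :: "'a::euclidean_space \<Rightarrow> 'a"
  assumes "bij_betw h (ball 0 1) (ball 0 1)" "conformal_factor h m" "h 0 = 0"
    and "x \<in> ball 0 1" "y \<in> ball 0 1"
  shows "norm (h x) = norm x" "norm (h x - h y) = norm (x - y)"
proof -
  note m = conformal_factorD [OF assms(2)]
  define k where "k = inv_into (ball 0 1) h"
  have bk: "bij_betw k (ball 0 1) (ball 0 1)" unfolding k_def by (rule bij_betw_inv_into [OF assms(1)])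
  have kh: "k (h x) = x" if "x \<in> ball 0 1" for x
    unfolding k_def by (rule bij_betw_inv_into_left [OF assms(1) that])
  have k0: "k 0 = 0" using kh[of 0] assms(3) by simp
  have m0: "m 0 > 0" using m(1) by simp
  have main: "norm (h x) = norm x \<and> m 0 = 1" if x: "x \<in> ball 0 1" "x \<noteq> 0" for x
  proof -
    define u v c where "u = norm x" and "v = norm (h x)" and "c = m 0"
    have hx: "h x \<in> ball 0 1" using assms(1) x by (auto simp: bij_betw_def)
    have hx0: "h x \<noteq> 0" using kh[OF x(1)] k0 x by metis
    have pos: "u > 0" "v > 0" "c > 0" using x hx0 m0 by (auto simp: u_def v_def c_def)
    have 1: "v * (1 + u) \<le> (1 + v) * (c * u)" "(1 - v) * (c * u) \<le> v * (1 - u)"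
      using origin_fixing_norm_bounds [OF assms(1-3) x] by (auto simp: u_def v_def c_def)
    have "u * (1 + v) \<le> (1 + u) * ((1 / c) * v)" "(1 - u) * ((1 / c) * v) \<le> u * (1 - v)"
      using origin_fixing_norm_bounds [OF bk conformal_factor_inv [OF assms(1,2), folded k_def] k0 hx hx0] kh[OF x(1)] k0
      by (auto simp: u_def v_def c_def)
    then have 2: "(1 + v) * (c * u) \<le> v * (1 + u)" "v * (1 - u) \<le> (1 - v) * (c * u)"
      using pos by (simp_all add: field_simps)
    \<comment> \<open>Adding the equalities \<open>v (1 + u) = (1 + v) c u\<close> and
      \<open>v (1 - u) = (1 - v) c u\<close> gives this; inserting it into the first gives
      \<open>u = v\<close>.\<close>
    have "v = c * u" using 1 2 by (simp add: algebra_simps)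
    moreover from this have "v * (1 + u) = (1 + v) * v" using 1 2 by simp
    then have "u = v" using pos by simp
    ultimately show ?thesis using pos by (simp add: u_def v_def c_def)
  qed
  show nx: "norm (h x) = norm x" using main[of x] assms(3,4) by (cases "x = 0") auto
  have mz: "m z = 1" if "z \<in> ball 0 1" for z
  proof -
    \<comment> \<open>\<open>main\<close> speaks of nonzero points only, so some nonzero point is
      needed to read off \<open>m 0 = 1\<close>.\<close>
    obtain e :: 'a where e: "norm e = 1/2" by (metis vector_choose_size zero_le_divide_1_iff zero_le_numeral)
    then have "e \<in> ball 0 1" "e \<noteq> 0" by auto
    then have m01: "m 0 = 1" using main by blast
    show ?thesis
    proof (cases "z = 0")
      case False
      then have "(norm z)\<^sup>2 = m z * (norm z)\<^sup>2" using m(2)[of z 0] main[OF that] that assms(3) m01 by simp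
      then show ?thesis using False by simp
    qed (simp add: m01)
  qed
  have "(norm (h x - h y))\<^sup>2 = (norm (x - y))\<^sup>2" using m(2)[OF assms(4,5)] mz assms(4,5) by simp
  then show "norm (h x - h y) = norm (x - y)" by simp
qed

text \<open>For \<open>a \<noteq> 0\<close>, inversion in the sphere around \<open>a /\<^sub>R (norm a)\<^sup>2\<close> orthogonal to the unit sphere.\<close>

lemma ball_inversion:
  fixes a :: "'a::euclidean_space"
  assumes "a \<in> ball 0 1"
  obtains T m where "bij_betw T (ball 0 1) (ball 0 1)" "conformal_factor T m" "T 0 = a"
    "\<And>x. x \<in> ball 0 1 \<Longrightarrow> T (T x) = x"
    "\<And>x. x \<in> ball 0 1 \<Longrightarrow> 1 - (norm (T x))\<^sup>2 = m x * (1 - (norm x)\<^sup>2)"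
proof (cases "a = 0")
  case True
  then show ?thesis using that [of id "\<lambda>_. 1"] by (auto simp: conformal_factor_def)
next
  case False
  define c where "c = a /\<^sub>R (norm a)\<^sup>2"
  \<comment> \<open>The squared radius: the sphere is orthogonal to the unit sphere exactly if
    \<open>|c|^2 = 1 + R\<close>.\<close>
  define R where "R = (norm c)\<^sup>2 - 1"
  define m where "m x = R / (norm (x - c))\<^sup>2" for x
  define T where "T x = c + m x *\<^sub>R (x - c)" for x
  have nc: "norm c = 1 / norm a" using False by (simp add: c_def power2_eq_square field_simps)
  then have nc1: "norm c > 1" using assms False by simp
  have R: "R > 0" using nc1 by (simp add: R_def one_less_power)
  have xc: "x \<noteq> c" if "x \<in> ball 0 1" for x using that nc1 by auto
  have mpos: "m x > 0" if "x \<in> ball 0 1" for x using xc[OF that] R by (simp add: m_def)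
  have sq: "1 - (norm (T x))\<^sup>2 = m x * (1 - (norm x)\<^sup>2)" if "x \<in> ball 0 1" for x
  proof -
    have k: "m x * (norm (x - c))\<^sup>2 = R" using xc[OF that] by (simp add: m_def)
    have "(norm (T x))\<^sup>2 = c \<bullet> c + 2 * m x * (c \<bullet> (x - c)) + m x * (m x * (norm (x - c))\<^sup>2)"
      unfolding T_def power2_norm_eq_inner
      by (simp add: inner_add_left inner_add_right inner_commute algebra_simps)
    also have "\<dots> = c \<bullet> c + 2 * m x * (c \<bullet> (x - c)) + m x * R" using k by simp
    \<comment> \<open>Orthogonality is used in both directions: \<open>c \<bullet> c\<close> becomes
      \<open>1 + R\<close> with \<open>R = m x * |x - c|^2\<close>, and the other \<open>R\<close>
      becomes \<open>c \<bullet> c - 1\<close>. The terms with \<open>m x\<close> then complete the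
      square to \<open>|x|^2 - 1\<close>.\<close>
    also have "\<dots> = 1 + m x * (norm (x - c))\<^sup>2 + 2 * m x * (c \<bullet> (x - c)) + m x * (c \<bullet> c - 1)"
      using k by (simp add: R_def power2_norm_eq_inner)
    also have "\<dots> = 1 - m x * (1 - (norm x)\<^sup>2)"
      unfolding power2_norm_eq_inner
      by (simp add: inner_diff_left inner_diff_right inner_commute algebra_simps)
    finally show ?thesis by simp
  qed
  have Tb: "T x \<in> ball 0 1" if "x \<in> ball 0 1" for x
  proof -
    have "(norm x)\<^sup>2 < 1" using that by (simp add: abs_square_less_1)
    then have "(norm (T x))\<^sup>2 < 1" using sq[OF that] mpos[OF that] by (smt (verit) mult_pos_pos)
    then show ?thesis by (simp add: abs_square_less_1)
  qed
  have TT: "T (T x) = x" if "x \<in> ball 0 1" for x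
  proof -
    have "T x - c = m x *\<^sub>R (x - c)" by (simp add: T_def)
    then have "(norm (T x - c))\<^sup>2 = m x * (m x * (norm (x - c))\<^sup>2)"
      by (simp add: power_mult_distrib power2_eq_square)
    also have "\<dots> = m x * R" using xc[OF that] by (simp add: m_def)
    finally have "m (T x) * m x = 1" using mpos[OF that] R by (simp add: m_def [of "T x"])
    then have "m (T x) *\<^sub>R (T x - c) = x - c" by (simp add: \<open>T x - c = m x *\<^sub>R (x - c)\<close>)
    then show ?thesis by (simp add: T_def [of "T x"])
  qed
  show ?thesis
  proof (rule that [of T m])
    show "bij_betw T (ball 0 1) (ball 0 1)"
      by (rule bij_betw_byWitness [of _ T]) (use TT Tb in auto)
    show "conformal_factor T m" unfolding conformal_factor_def
    proof (intro conjI ballI)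
      fix x y :: 'a assume "x \<in> ball 0 1" "y \<in> ball 0 1"
      then show "(norm (T x - T y))\<^sup>2 = m x * m y * (norm (x - y))\<^sup>2"
        using inversion_dist [OF xc xc, of x y R] by (simp add: T_def m_def)
    qed (use mpos in auto)
    have "m 0 = 1 - (norm a)\<^sup>2" using False unfolding m_def R_def by (simp add: nc power_divide field_simps)
    moreover have "T 0 = (1 - m 0) *\<^sub>R c" by (simp add: T_def scaleR_diff_left)
    ultimately have "T 0 = (norm a)\<^sup>2 *\<^sub>R c" by simp
    then show "T 0 = a" using False by (simp add: c_def)
  qed (use TT sq in auto)
qed

section \<open>Invariance of the hyperbolic metric\<close>

text \<open>With denominators cleared, this is invariance of \<open>sinh(d/2)^2\<close>, where
  \<open>d\<close> is the hyperbolic distance of curvature -1.\<close>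

definition hyperbolic_isometry :: "('a::euclidean_space \<Rightarrow> 'a) \<Rightarrow> bool" where
  "hyperbolic_isometry h \<longleftrightarrow> bij_betw h (ball 0 1) (ball 0 1) \<and>
     (\<forall>x\<in>ball 0 1. \<forall>y\<in>ball 0 1.
        (norm (h x - h y))\<^sup>2 * ((1 - (norm x)\<^sup>2) * (1 - (norm y)\<^sup>2))
          = (norm (x - y))\<^sup>2 * ((1 - (norm (h x))\<^sup>2) * (1 - (norm (h y))\<^sup>2)))"

lemma moebius_self_map_hyperbolic_isometry:
  fixes h :: "'a::euclidean_space \<Rightarrow> 'a"
  assumes "moebius_self_map (ball 0 1) h"
  shows "hyperbolic_isometry h"
proof -
  obtain l where h: "bij_betw h (ball 0 1) (ball 0 1)" "conformal_factor h l"
    using moebius_self_map_distortion [OF assms] by blast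
  define a where "a = inv_into (ball 0 1) h 0"
  have a: "a \<in> ball 0 1" "h a = 0"
    using bij_betw_inv_into [OF h(1)] bij_betw_inv_into_right [OF h(1), of 0]
    by (auto simp: a_def bij_betw_def)
  obtain T m where T: "bij_betw T (ball 0 1) (ball 0 1)" "conformal_factor T m" "T 0 = a"
    "\<And>x. x \<in> ball 0 1 \<Longrightarrow> T (T x) = x"
    "\<And>x. x \<in> ball 0 1 \<Longrightarrow> 1 - (norm (T x))\<^sup>2 = m x * (1 - (norm x)\<^sup>2)"
    using ball_inversion [OF a(1)] by metis
  have Tb: "T x \<in> ball 0 1" if "x \<in> ball 0 1" for x using T(1) that by (auto simp: bij_betw_def)
  have g: "bij_betw (h \<circ> T) (ball 0 1) (ball 0 1)" "conformal_factor (h \<circ> T) (\<lambda>x. l (T x) * m x)" "(h \<circ> T) 0 = 0"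
    using bij_betw_trans [OF T(1) h(1)] conformal_factor_comp [OF h(2) T(2)] T(1,3) a by (auto simp: bij_betw_def)
  \<comment> \<open>As \<open>T\<close> is an involution, \<open>h\<close> is
    \<open>(h \<circ> T) \<circ> T\<close> on the ball, and the outer map is an isometry fixing 0.
    So every norm in the claim may be computed for \<open>T\<close>.\<close>
  have hT: "norm (h x) = norm (T x)" "norm (h x - h y) = norm (T x - T y)" if "x \<in> ball 0 1" "y \<in> ball 0 1" for x y
    using origin_fixing_isometry [OF g, of "T x" "T y"] Tb T(4) that by auto
  show ?thesis unfolding hyperbolic_isometry_def
  proof (intro conjI ballI h(1))
    fix x y :: 'a assume xy: "x \<in> ball 0 1" "y \<in> ball 0 1"
    show "(norm (h x - h y))\<^sup>2 * ((1 - (norm x)\<^sup>2) * (1 - (norm y)\<^sup>2))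
          = (norm (x - y))\<^sup>2 * ((1 - (norm (h x))\<^sup>2) * (1 - (norm (h y))\<^sup>2))"
      unfolding hT(2)[OF xy] hT(1)[OF xy(1) xy(1)] hT(1)[OF xy(2) xy(2)]
        T(5)[OF xy(1)] T(5)[OF xy(2)] conformal_factorD(2) [OF T(2) xy] by simp
  qed
qed

subsection \<open>Arc length\<close>

text \<open>A free starting parameter \<open>s\<close> is needed because lengths have to be added
  over adjacent intervals and compared locally.\<close>

definition polygon_lengths :: "(real \<Rightarrow> 'a::metric_space) \<Rightarrow> real \<Rightarrow> real \<Rightarrow> real set" where
  "polygon_lengths g s t =
     {(\<Sum>i<m. dist (g (p i)) (g (p (Suc i)))) | (p :: nat \<Rightarrow> real) m.
        mono p \<and> p 0 = s \<and> p m = t}"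

definition variation :: "(real \<Rightarrow> 'a::metric_space) \<Rightarrow> real \<Rightarrow> real \<Rightarrow> real" where
  "variation g s t = Sup (polygon_lengths g s t)"

lemma arc_length_eq_variation: "arc_length g t = variation g 0 t"
  by (simp add: arc_length_def variation_def inscribed_lengths_def polygon_lengths_def)

lemma dist_in_polygon_lengths:
  assumes "s \<le> t"
  shows "dist (g s) (g t) \<in> polygon_lengths g s t"
  unfolding polygon_lengths_def
  by (rule CollectI, rule exI [of _ "\<lambda>i. if i = 0 then s else t"], rule exI [of _ 1])
    (use assms in \<open>auto simp: mono_def\<close>)

lemma polygon_lengths_concat:
  assumes "a \<in> polygon_lengths g s t" "b \<in> polygon_lengths g t u"
  shows "a + b \<in> polygon_lengths g s u"
proof -
  obtain p m where p: "a = (\<Sum>i<m. dist (g (p i)) (g (p (Suc i))))" "mono p" "p 0 = s" "p m = t"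
    using assms(1) by (auto simp: polygon_lengths_def)
  obtain q n where q: "b = (\<Sum>i<n. dist (g (q i)) (g (q (Suc i))))" "mono q" "q 0 = t" "q n = u"
    using assms(2) by (auto simp: polygon_lengths_def)
  \<comment> \<open>The common vertex \<open>p m = q 0 = t\<close> is stored once, at index
    \<open>m\<close>, so no edge is lost or inserted at the junction.\<close>
  define r where "r i = (if i \<le> m then p i else q (i - m))" for i
  have "mono r"
  proof (rule monoI)
    fix i j :: nat assume ij: "i \<le> j"
    have "p i \<le> t" if "i \<le> m" using that p(2,4) by (auto simp: mono_def)
    moreover have "t \<le> q k" for k using q(2,3) by (auto simp: mono_def)
    ultimately show "r i \<le> r j"
      using ij p(2) q(2) by (auto simp: r_def mono_def intro: order_trans)
  qed
  have "(\<Sum>i<m + n. dist (g (r i)) (g (r (Suc i))))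
      = (\<Sum>i<m. dist (g (r i)) (g (r (Suc i)))) + (\<Sum>i<n. dist (g (r (m + i))) (g (r (Suc (m + i)))))"
    by (induction n) auto
  also have "(\<Sum>i<m. dist (g (r i)) (g (r (Suc i)))) = a"
    unfolding p(1) by (intro sum.cong) (auto simp: r_def)
  also have "(\<Sum>i<n. dist (g (r (m + i))) (g (r (Suc (m + i))))) = b"
    unfolding q(1) using p(4) q(3) by (intro sum.cong) (auto simp: r_def)
  finally have "a + b = (\<Sum>i<m + n. dist (g (r i)) (g (r (Suc i))))" by simp
  moreover have "r 0 = s" "r (m + n) = u" using p q by (auto simp: r_def)
  ultimately show ?thesis using \<open>mono r\<close> by (auto simp: polygon_lengths_def)
qed

text \<open>Clipping the parameters with \<open>min\<close> and \<open>max\<close> keeps the index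
  range, so the edge across \<open>t\<close> need not be located: edges on the wrong side of
  \<open>t\<close> collapse to length 0, and only an edge across \<open>t\<close> calls for the
  triangle inequality. The clipped sum also depends continuously on \<open>t\<close> if
  \<open>g\<close> is continuous.\<close>

lemma clipped_polygon_lengths:
  fixes g :: "real \<Rightarrow> 'a::metric_space"
  assumes "mono p" "p 0 = s" "p m = u" "s \<le> t" "t \<le> u"
  shows "(\<Sum>i<m. dist (g (min (p i) t)) (g (min (p (Suc i)) t))) \<in> polygon_lengths g s t"
    and "(\<Sum>i<m. dist (g (max (p i) t)) (g (max (p (Suc i)) t))) \<in> polygon_lengths g t u"
    and "(\<Sum>i<m. dist (g (p i)) (g (p (Suc i))))
      \<le> (\<Sum>i<m. dist (g (min (p i) t)) (g (min (p (Suc i)) t)))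
        + (\<Sum>i<m. dist (g (max (p i) t)) (g (max (p (Suc i)) t)))"
proof -
  show "(\<Sum>i<m. dist (g (min (p i) t)) (g (min (p (Suc i)) t))) \<in> polygon_lengths g s t"
    unfolding polygon_lengths_def using assms
    by (intro CollectI exI [of _ "\<lambda>i. min (p i) t"] exI [of _ m]) (auto simp: mono_def min.coboundedI1)
  show "(\<Sum>i<m. dist (g (max (p i) t)) (g (max (p (Suc i)) t))) \<in> polygon_lengths g t u"
    unfolding polygon_lengths_def using assms
    by (intro CollectI exI [of _ "\<lambda>i. max (p i) t"] exI [of _ m]) (auto simp: mono_def max.coboundedI1)
  have "dist (g (p i)) (g (p (Suc i)))
    \<le> dist (g (min (p i) t)) (g (min (p (Suc i)) t)) + dist (g (max (p i) t)) (g (max (p (Suc i)) t))" for i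
  proof -
    have "p i \<le> p (Suc i)" using assms(1) by (simp add: mono_def)
    then show ?thesis using dist_triangle [of "g (p i)" "g (p (Suc i))" "g t"]
      by (auto simp: min_def max_def)
  qed
  then show "(\<Sum>i<m. dist (g (p i)) (g (p (Suc i))))
      \<le> (\<Sum>i<m. dist (g (min (p i) t)) (g (min (p (Suc i)) t)))
        + (\<Sum>i<m. dist (g (max (p i) t)) (g (max (p (Suc i)) t)))"
    unfolding sum.distrib [symmetric] by (intro sum_mono)
qed

lemma polygon_lengths_lipschitz:
  assumes "c \<in> polygon_lengths f s t" "\<And>u v. \<lbrakk>u \<in> {s..t}; v \<in> {s..t}\<rbrakk> \<Longrightarrow> dist (f u) (f v) \<le> L * dist (g u) (g v)"
  obtains b where "b \<in> polygon_lengths g s t" "c \<le> L * b"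
proof -
  obtain p m where p: "c = (\<Sum>i<m. dist (f (p i)) (f (p (Suc i))))" "mono p" "p 0 = s" "p m = t"
    using assms(1) by (auto simp: polygon_lengths_def)
  have "p i \<in> {s..t}" if "i \<le> m" for i using p(2-4) that by (auto simp: mono_def)
  then have "c \<le> L * (\<Sum>i<m. dist (g (p i)) (g (p (Suc i))))"
    unfolding p(1) sum_distrib_left by (intro sum_mono assms(2)) auto
  moreover have "(\<Sum>i<m. dist (g (p i)) (g (p (Suc i)))) \<in> polygon_lengths g s t"
    using p by (auto simp: polygon_lengths_def)
  ultimately show ?thesis using that by blast
qed

section \<open>Integrals over arcs and the comparison principle\<close>

definition partial_integral :: "(real \<Rightarrow> 'a::metric_space) \<Rightarrow> ('a \<Rightarrow> real) \<Rightarrow> real \<Rightarrow> real" where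
  "partial_integral g \<rho> t = integral {0..arc_length g t} (\<lambda>s. \<rho> (arc_length_param g s))"

lemma partial_integral_1: "partial_integral g \<rho> 1 = arc_length_integral g \<rho>"
  by (simp add: partial_integral_def arc_length_integral_def)

context
  fixes g :: "real \<Rightarrow> 'a::metric_space"
  assumes rect: "rectifiable_path g"
begin

lemma polygon_lengths_bdd:
  assumes "0 \<le> s" "s \<le> t" "t \<le> 1"
  shows "bdd_above (polygon_lengths g s t)"
proof -
  obtain M where M: "\<And>c. c \<in> polygon_lengths g 0 1 \<Longrightarrow> c \<le> M"
    using rect by (auto simp: rectifiable_path_def bdd_above_def inscribed_lengths_def polygon_lengths_def)
  show ?thesis
  proof (rule bdd_aboveI)
    fix c assume "c \<in> polygon_lengths g s t"
    \<comment> \<open>A polygon over \<open>{s..t}\<close> is completed to one over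
      \<open>{0..1}\<close> by two chords.\<close>
    then have "dist (g 0) (g s) + c + dist (g t) (g 1) \<in> polygon_lengths g 0 1"
      using assms by (intro polygon_lengths_concat [of _ g 0 t] polygon_lengths_concat [of _ g 0 s] dist_in_polygon_lengths)
    from M [OF this] show "c \<le> M" using zero_le_dist [of "g 0" "g s"] zero_le_dist [of "g t" "g 1"] by linarith
  qed
qed

lemma variation_upper:
  assumes "0 \<le> s" "s \<le> t" "t \<le> 1" "c \<in> polygon_lengths g s t"
  shows "c \<le> variation g s t"
  unfolding variation_def using polygon_lengths_bdd assms by (intro cSup_upper) auto

lemma dist_le_variation:
  assumes "0 \<le> s" "s \<le> t" "t \<le> 1"
  shows "dist (g s) (g t) \<le> variation g s t"
  using assms by (intro variation_upper dist_in_polygon_lengths)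

lemma variation_least:
  assumes "s \<le> t" "\<And>c. c \<in> polygon_lengths g s t \<Longrightarrow> c \<le> M"
  shows "variation g s t \<le> M"
  unfolding variation_def using assms dist_in_polygon_lengths [OF assms(1), of g]
  by (intro cSup_least) auto

lemma variation_add:
  assumes "0 \<le> s" "s \<le> t" "t \<le> u" "u \<le> 1"
  shows "variation g s u = variation g s t + variation g t u"
proof (rule antisym)
  show "variation g s u \<le> variation g s t + variation g t u"
  proof (rule variation_least)
    fix c assume "c \<in> polygon_lengths g s u"
    then obtain p m where p: "c = (\<Sum>i<m. dist (g (p i)) (g (p (Suc i))))" "mono p" "p 0 = s" "p m = u"
      by (auto simp: polygon_lengths_def)
    note clip = clipped_polygon_lengths [OF p(2-4) assms(2,3), of g]
    show "c \<le> variation g s t + variation g t u"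
      using clip(3) variation_upper [OF _ _ _ clip(1)] variation_upper [OF _ _ _ clip(2)] assms
      unfolding p(1) by linarith
  qed (use assms in linarith)
  have "variation g s t \<le> variation g s u - variation g t u"
  proof (rule variation_least [OF assms(2)])
    fix a assume a: "a \<in> polygon_lengths g s t"
    have "variation g t u \<le> variation g s u - a"
    proof (rule variation_least [OF assms(3)])
      fix b assume "b \<in> polygon_lengths g t u"
      then have "a + b \<le> variation g s u"
        using assms by (intro variation_upper polygon_lengths_concat [OF a]) auto
      then show "b \<le> variation g s u - a" by linarith
    qed
    then show "a \<le> variation g s u - variation g t u" by linarith
  qed
  then show "variation g s t + variation g t u \<le> variation g s u" by linarith
qed

lemma variation_nonneg:
  assumes "0 \<le> s" "s \<le> t" "t \<le> 1"
  shows "0 \<le> variation g s t"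
  using dist_le_variation [OF assms] zero_le_dist [of "g s" "g t"] by linarith

lemma arc_length_diff:
  assumes "0 \<le> s" "s \<le> t" "t \<le> 1"
  shows "arc_length g t - arc_length g s = variation g s t"
  using variation_add [of 0 s t] assms by (simp add: arc_length_eq_variation)

lemma arc_length_mono:
  assumes "0 \<le> s" "s \<le> t" "t \<le> 1"
  shows "arc_length g s \<le> arc_length g t"
  using arc_length_diff [OF assms] variation_nonneg [OF assms] by linarith

lemma arc_length_0: "arc_length g 0 = 0"
  using variation_add [of 0 0 0] by (simp add: arc_length_eq_variation)

lemma partial_integral_0: "partial_integral g \<rho> 0 = 0"
  by (simp add: partial_integral_def arc_length_0)

lemma dist_le_arc_length:
  assumes "s \<in> {0..1}" "t \<in> {0..1}"
  shows "dist (g s) (g t) \<le> \<bar>arc_length g s - arc_length g t\<bar>"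
proof (cases "s \<le> t")
  case True
  then show ?thesis using dist_le_variation [of s t] arc_length_diff [of s t] assms by auto
next
  case False
  then show ?thesis using dist_le_variation [of t s] arc_length_diff [of t s] assms by (auto simp: dist_commute)
qed

text \<open>
  Cutting off a fixed nearly optimal polygon at \<open>t\<close> gives a continuous function of \<open>t\<close> whose
  distance to \<open>arc_length g t\<close> is at most the defect of the whole polygon. So the arc length
  is a uniform limit of continuous functions.
\<close>

lemma arc_length_continuous: "continuous_on {0..1} (arc_length g)"
proof -
  have approx: "\<exists>f. continuous_on {0..1} f \<and> (\<forall>t\<in>{0..1}. \<bar>f t - arc_length g t\<bar> < e)" if e: "e > 0" for e
  proof -
    have ne: "polygon_lengths g 0 1 \<noteq> {}" using dist_in_polygon_lengths [of 0 1 g] by auto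
    obtain c where c: "c \<in> polygon_lengths g 0 1" "variation g 0 1 - e < c"
      using less_cSup_iff [OF ne polygon_lengths_bdd, of "variation g 0 1 - e"] e by (auto simp: variation_def)
    then obtain p m where p: "c = (\<Sum>i<m. dist (g (p i)) (g (p (Suc i))))" "mono p" "p 0 = 0" "p m = 1"
      by (auto simp: polygon_lengths_def)
    define f where "f t = (\<Sum>i<m. dist (g (min (p i) t)) (g (min (p (Suc i)) t)))" for t
    have gc: "continuous_on {0..1} g" using rect by (simp add: rectifiable_path_def path_def)
    have p0: "0 \<le> p i" for i using p(2,3) by (metis monoD zero_le)
    have "continuous_on {0..1} (\<lambda>t. g (min (p i) t))" for i
      by (rule continuous_on_compose2 [OF gc]) (use p0 in \<open>auto intro!: continuous_intros\<close>)
    then have "continuous_on {0..1} f" unfolding f_def by (intro continuous_intros)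
    moreover have "\<bar>f t - arc_length g t\<bar> < e" if t: "t \<in> {0..1}" for t
    proof -
      have t01: "0 \<le> t" "t \<le> 1" using t by auto
      note clip = clipped_polygon_lengths [OF p(2-4) t01, of g, folded f_def p(1)]
      have "f t \<le> variation g 0 t" "c - f t \<le> variation g t 1"
        using clip(3) variation_upper [OF _ _ _ clip(1)] variation_upper [OF _ _ _ clip(2)] t01 by auto
      then show ?thesis using c(2) variation_add [of 0 t 1] t01 by (simp add: arc_length_eq_variation)
    qed
    ultimately show ?thesis by blast
  qed
  have "\<exists>f. continuous_on {0..1} f \<and> (\<forall>t\<in>{0..1}. \<bar>f t - arc_length g t\<bar> < inverse (real (Suc n)))" for n
    by (rule approx) simp
  then obtain f where f: "\<And>n. continuous_on {0..1} (f n)"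
    "\<And>n t. t \<in> {0..1} \<Longrightarrow> \<bar>f n t - arc_length g t\<bar> < inverse (real (Suc n))" by metis
  have "uniform_limit {0..1} f (arc_length g) sequentially"
  proof (rule uniform_limitI)
    fix e :: real assume "e > 0"
    then have "\<forall>\<^sub>F n in sequentially. inverse (real (Suc n)) < e"
      using order_tendstoD(2) [OF LIMSEQ_inverse_real_of_nat] by blast
    then show "\<forall>\<^sub>F n in sequentially. \<forall>t\<in>{0..1}. dist (f n t) (arc_length g t) < e"
      by eventually_elim (metis dist_real_def f(2) less_trans)
  qed
  then show ?thesis using f(1) by (intro uniform_limit_theorem [OF always_eventually]) auto
qed

lemma arc_length_surj:
  assumes "0 \<le> a" "a \<le> b" "b \<le> 1" "arc_length g a \<le> s" "s \<le> arc_length g b"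
  shows "\<exists>t\<in>{a..b}. arc_length g t = s"
  using IVT' [of "arc_length g" a s b] assms continuous_on_subset [OF arc_length_continuous, of "{a..b}"]
  by auto

lemma arc_length_param_eq:
  assumes "t \<in> {0..1}"
  shows "arc_length_param g (arc_length g t) = g t"
proof -
  define u where "u = (SOME u. u \<in> {0..1} \<and> arc_length g u = arc_length g t)"
  have "u \<in> {0..1} \<and> arc_length g u = arc_length g t"
    unfolding u_def by (rule someI [of _ t]) (use assms in auto)
  then have "dist (g u) (g t) \<le> 0" using dist_le_arc_length [of u t] assms by auto
  then show ?thesis by (simp add: arc_length_param_def u_def)
qed

text \<open>The parametrization is 1-Lipschitz, since a chord is no longer than its arc.\<close>

lemma arc_length_param_continuous: "continuous_on {0..arc_length g 1} (arc_length_param g)"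
proof -
  have *: "\<exists>t\<in>{0..1}. arc_length g t = s" if "s \<in> {0..arc_length g 1}" for s
    using arc_length_surj [of 0 1 s] that arc_length_0 by auto
  have "dist (arc_length_param g s) (arc_length_param g t) \<le> dist s t"
    if "s \<in> {0..arc_length g 1}" "t \<in> {0..arc_length g 1}" for s t
    using *[OF that(1)] *[OF that(2)] arc_length_param_eq dist_le_arc_length by (auto simp: dist_real_def)
  then show ?thesis unfolding continuous_on_iff by (meson order_le_less_trans)
qed

lemma weight_param_continuous:
  assumes "continuous_on (path_image g) \<rho>"
  shows "continuous_on {0..arc_length g 1} (\<lambda>s. \<rho> (arc_length_param g s))"
proof (rule continuous_on_compose2 [OF assms arc_length_param_continuous])
  show "arc_length_param g ` {0..arc_length g 1} \<subseteq> path_image g"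
  proof (rule image_subsetI)
    fix s assume "s \<in> {0..arc_length g 1}"
    then obtain t where "t \<in> {0..1}" "arc_length g t = s"
      using arc_length_surj [of 0 1 s] arc_length_0 by auto
    then show "arc_length_param g s \<in> path_image g"
      using arc_length_param_eq [of t] by (auto simp: path_image_def)
  qed
qed

lemma partial_integral_diff:
  fixes \<rho> :: "'a \<Rightarrow> real"
  assumes "continuous_on (path_image g) \<rho>" "0 \<le> s" "s \<le> t" "t \<le> 1"
  shows "partial_integral g \<rho> t - partial_integral g \<rho> s
      = integral {arc_length g s..arc_length g t} (\<lambda>s. \<rho> (arc_length_param g s))"
    and "(\<lambda>s. \<rho> (arc_length_param g s)) integrable_on {arc_length g s..arc_length g t}"
proof -
  have o: "0 \<le> arc_length g s" "arc_length g s \<le> arc_length g t" "arc_length g t \<le> arc_length g 1"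
    using arc_length_mono [of 0 s] arc_length_mono [of s t] arc_length_mono [of t 1] assms arc_length_0 by auto
  have int: "(\<lambda>s. \<rho> (arc_length_param g s)) integrable_on {a..b}" if "0 \<le> a" "b \<le> arc_length g 1" for a b
    by (rule integrable_continuous_real, rule continuous_on_subset [OF weight_param_continuous [OF assms(1)]])
      (use that in auto)
  show "partial_integral g \<rho> t - partial_integral g \<rho> s
      = integral {arc_length g s..arc_length g t} (\<lambda>s. \<rho> (arc_length_param g s))"
    unfolding partial_integral_def
    using Henstock_Kurzweil_Integration.integral_combine [OF o(1,2) int] o by simp
  show "(\<lambda>s. \<rho> (arc_length_param g s)) integrable_on {arc_length g s..arc_length g t}"
    using int o by simp
qed

text \<open>The difference of the partial integrals is an integral over an interval of length
  \<open>variation g s t\<close>, on which the parametrization takes only values \<open>g u\<close>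
  with \<open>u\<close> in \<open>{s..t}\<close>.\<close>

lemma partial_integral_bounds:
  fixes \<rho> :: "'a \<Rightarrow> real"
  assumes "continuous_on (path_image g) \<rho>" "0 \<le> s" "s \<le> t" "t \<le> 1"
  shows "(\<And>u. u \<in> {s..t} \<Longrightarrow> c \<le> \<rho> (g u)) \<Longrightarrow>
      c * variation g s t \<le> partial_integral g \<rho> t - partial_integral g \<rho> s"
    and "(\<And>u. u \<in> {s..t} \<Longrightarrow> \<rho> (g u) \<le> c) \<Longrightarrow>
      partial_integral g \<rho> t - partial_integral g \<rho> s \<le> c * variation g s t"
proof -
  have o: "arc_length g s \<le> arc_length g t" by (intro arc_length_mono assms)
  have ic: "integral {arc_length g s..arc_length g t} (\<lambda>_. c) = c * variation g s t"
    using o arc_length_diff [OF assms(2-4)] by simp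
  have par: "\<exists>u\<in>{s..t}. arc_length_param g r = g u" if r: "r \<in> {arc_length g s..arc_length g t}" for r
  proof -
    obtain u where "u \<in> {s..t}" "arc_length g u = r"
      using arc_length_surj [OF assms(2-4), of r] r by auto
    then show ?thesis using arc_length_param_eq [of u] assms by (intro bexI [of _ u]) auto
  qed
  note J = partial_integral_diff [OF assms(1-4)]
  show "c * variation g s t \<le> partial_integral g \<rho> t - partial_integral g \<rho> s"
    if c: "\<And>u. u \<in> {s..t} \<Longrightarrow> c \<le> \<rho> (g u)"
    unfolding J(1) ic [symmetric]
  proof (rule integral_le [OF _ J(2)])
    show "c \<le> \<rho> (arc_length_param g r)" if "r \<in> {arc_length g s..arc_length g t}" for r
      using par [OF that] c by auto
  qed (rule integrable_const_ivl)
  show "partial_integral g \<rho> t - partial_integral g \<rho> s \<le> c * variation g s t"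
    if c: "\<And>u. u \<in> {s..t} \<Longrightarrow> \<rho> (g u) \<le> c"
    unfolding J(1) ic [symmetric]
  proof (rule integral_le [OF J(2)])
    show "\<rho> (arc_length_param g r) \<le> c" if "r \<in> {arc_length g s..arc_length g t}" for r
      using par [OF that] c by auto
  qed (rule integrable_const_ivl)
qed

text \<open>This plays the role of integrating \<open>dA \<le> C \<rho> ds\<close>. For
  \<open>D > C\<close> there is room at each point for a \<open>K\<close> strictly between
  \<open>C \<rho>\<close> and \<open>D \<rho>\<close>; continuity of the weight gives the estimate
  with \<open>D\<close> on short intervals, bisection makes it global, and \<open>D\<close> tends to
  \<open>C\<close>.\<close>

lemma increment_le_arc_length_integral:
  fixes \<rho> :: "'a \<Rightarrow> real" and A :: "real \<Rightarrow> real"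
  assumes \<rho>: "continuous_on (path_image g) \<rho>" "\<And>z. z \<in> path_image g \<Longrightarrow> \<rho> z > 0" and C: "C \<ge> 0"
    and local: "\<And>x K. \<lbrakk>x \<in> {0..1}; C * \<rho> (g x) < K\<rbrakk> \<Longrightarrow>
      \<exists>d>0. \<forall>s t. 0 \<le> s \<and> s \<le> x \<and> x \<le> t \<and> t \<le> 1 \<and> t - s < d \<longrightarrow> A t - A s \<le> K * variation g s t"
  shows "A 1 - A 0 \<le> C * arc_length_integral g \<rho>"
proof -
  define J where "J = partial_integral g \<rho>"
  have J01: "J 1 = arc_length_integral g \<rho>" "J 0 = 0"
    by (simp_all add: J_def partial_integral_1 partial_integral_0)
  have main: "A 1 - A 0 \<le> D * (J 1 - J 0)" if D: "C < D" for D
  proof -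
    \<comment> \<open>The bisection rule offers short intervals around \<open>x\<close> that may
      leave \<open>{0..1}\<close>; there the guard makes \<open>P\<close> vacuous.\<close>
    define P where "P s t \<longleftrightarrow> (0 \<le> s \<and> t \<le> 1 \<longrightarrow> A t - A s \<le> D * (J t - J s))" for s t
    have "(0::real) \<le> 1" by simp
    then have "P 0 1"
    proof (induction rule: Bolzano)
      case (trans a b c)
      then show ?case by (auto simp: P_def algebra_simps)
    next
      case (local x)
      then have x: "x \<in> {0..1}" by simp
      then have \<rho>x: "\<rho> (g x) > 0" using \<rho>(2) by (simp add: path_image_def)
      define K where "K = (C + D) / 2 * \<rho> (g x)"
      have K: "C * \<rho> (g x) < K" "K < D * \<rho> (g x)" using D \<rho>x by (auto simp: K_def field_simps)
      have D0: "D > 0" "K \<ge> 0" using C D \<rho>x by (auto simp: K_def)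
      have "continuous_on {0..1} (\<lambda>t. \<rho> (g t))"
        using rect by (intro continuous_on_compose2 [OF \<rho>(1)]) (auto simp: rectifiable_path_def path_def path_image_def)
      then have "((\<lambda>t. \<rho> (g t)) \<longlongrightarrow> \<rho> (g x)) (at x within {0..1})" using x by (simp add: continuous_on)
      moreover have "K / D < \<rho> (g x)" using K(2) D0 by (simp add: field_simps)
      ultimately have "\<forall>\<^sub>F t in at x within {0..1}. K / D < \<rho> (g t)" by (rule order_tendstoD)
      then obtain d1 where d1: "d1 > 0" "\<And>t. \<lbrakk>t \<in> {0..1}; t \<noteq> x; dist t x < d1\<rbrakk> \<Longrightarrow> K / D < \<rho> (g t)"
        unfolding eventually_at by auto
      then have d1': "K / D \<le> \<rho> (g t)" if "t \<in> {0..1}" "\<bar>t - x\<bar> < d1" for t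
        using that \<open>K / D < \<rho> (g x)\<close> by (cases "t = x") (auto simp: dist_real_def intro: less_imp_le)
      obtain d2 where d2: "d2 > 0" "\<And>s t. \<lbrakk>0 \<le> s; s \<le> x; x \<le> t; t \<le> 1; t - s < d2\<rbrakk> \<Longrightarrow> A t - A s \<le> K * variation g s t"
        using assms(4) [OF x K(1)] by auto
      show ?case
      proof (intro exI [of _ "min d1 d2"] conjI allI impI)
        show "min d1 d2 > 0" using d1 d2 by simp
        fix s t assume st: "s \<le> x \<and> x \<le> t \<and> t - s < min d1 d2"
        show "P s t" unfolding P_def
        proof
          assume st1: "0 \<le> s \<and> t \<le> 1"
          have "(K / D) * variation g s t \<le> J t - J s"
            unfolding J_def by (rule partial_integral_bounds(1) [OF \<rho>(1)]) (use st st1 d1' in auto)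
          then have "D * ((K / D) * variation g s t) \<le> D * (J t - J s)" using D0 by (intro mult_left_mono) auto
          then show "A t - A s \<le> D * (J t - J s)" using d2(2)[of s t] st st1 D0 by simp
        qed
      qed
    qed
    then show ?thesis by (simp add: P_def)
  qed
  have lim: "((\<lambda>D. D * (J 1 - J 0)) \<longlongrightarrow> C * (J 1 - J 0)) (at_right C)" by (intro tendsto_intros)
  have "A 1 - A 0 \<le> C * (J 1 - J 0)"
    by (rule tendsto_lowerbound [OF lim]) (use main in \<open>auto simp: eventually_at_filter\<close>)
  then show ?thesis by (simp add: J01)
qed

end

section \<open>Pointwise estimates for hyperbolic isometries\<close>

lemma hyperbolic_isometryD:
  assumes "hyperbolic_isometry h"
  shows "bij_betw h (ball 0 1) (ball 0 1)" "x \<in> ball 0 1 \<Longrightarrow> norm (h x) < 1"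
    "\<lbrakk>x \<in> ball 0 1; y \<in> ball 0 1\<rbrakk> \<Longrightarrow>
      (norm (h x - h y))\<^sup>2 * ((1 - (norm x)\<^sup>2) * (1 - (norm y)\<^sup>2))
        = (norm (x - y))\<^sup>2 * ((1 - (norm (h x))\<^sup>2) * (1 - (norm (h y))\<^sup>2))"
  using assms by (auto simp: hyperbolic_isometry_def bij_betw_def)

lemma hyperbolic_isometry_inv:
  assumes "hyperbolic_isometry h"
  shows "hyperbolic_isometry (inv_into (ball 0 1) h)"
proof -
  define k where "k = inv_into (ball 0 1) h"
  note h = hyperbolic_isometryD [OF assms]
  have bk: "bij_betw k (ball 0 1) (ball 0 1)" unfolding k_def by (rule bij_betw_inv_into [OF h(1)])
  have k: "k y \<in> ball 0 1" "h (k y) = y" if "y \<in> ball 0 1" for y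
    using bk that bij_betw_inv_into_right [OF h(1) that] by (auto simp: k_def bij_betw_def)
  have "hyperbolic_isometry k" unfolding hyperbolic_isometry_def
  proof (intro conjI ballI bk)
    fix x y :: 'a assume xy: "x \<in> ball 0 1" "y \<in> ball 0 1"
    show "(norm (k x - k y))\<^sup>2 * ((1 - (norm x)\<^sup>2) * (1 - (norm y)\<^sup>2))
          = (norm (x - y))\<^sup>2 * ((1 - (norm (k x))\<^sup>2) * (1 - (norm (k y))\<^sup>2))"
      using h(3) [OF k(1) k(1), OF xy] k(2)[OF xy(1)] k(2)[OF xy(2)] by simp
  qed
  then show ?thesis by (simp add: k_def)
qed

lemma one_minus_norm_sq_pos: "x \<in> ball 0 1 \<Longrightarrow> 0 < 1 - (norm x)\<^sup>2"
  by (simp add: abs_square_less_1)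

lemma hyperbolic_isometry_center:
  assumes h: "hyperbolic_isometry h" and a: "a \<in> ball 0 1" "h a = 0"
  shows "norm (h 0) = norm a"
proof -
  have "(norm (h 0))\<^sup>2 * (1 - (norm a)\<^sup>2) = (norm a)\<^sup>2 * (1 - (norm (h 0))\<^sup>2)"
    using hyperbolic_isometryD(3) [OF h, of 0 a] a by simp
  then have "(norm (h 0))\<^sup>2 = (norm a)\<^sup>2" by (simp add: algebra_simps)
  then show ?thesis by simp
qed

text \<open>Since \<open>h a = 0\<close>, invariance for the pair \<open>x\<close>, \<open>a\<close>
  gives \<open>|h x|^2 = E / (Q + E)\<close> with \<open>E = |x - a|^2\<close> and
  \<open>Q = (1 - |x|^2) (1 - |a|^2)\<close>. This increases with \<open>E\<close>, which is at most
  \<open>(|x| + |a|)^2\<close>. The equality case, \<open>x\<close> and \<open>a\<close> on opposite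
  rays, supplies the extremal points for sharpness.\<close>

lemma hyperbolic_isometry_norm:
  assumes h: "hyperbolic_isometry h" and a: "a \<in> ball 0 1" "h a = 0" and x: "x \<in> ball 0 1"
  defines "s \<equiv> (norm x + norm a) / (1 + norm x * norm a)"
  shows "norm (h x) \<le> s" and "norm (x - a) = norm x + norm a \<Longrightarrow> norm (h x) = s"
proof -
  define u b v where "u = norm x" and "b = norm a" and "v = norm (h x)"
  have ub: "0 \<le> u" "u < 1" "0 \<le> b" "b < 1" "0 \<le> v" "v < 1"
    using x a(1) hyperbolic_isometryD(2) [OF h x] by (auto simp: u_def b_def v_def)
  have pos: "0 < 1 + u * b" using ub by (simp add: add_pos_nonneg)
  have pos2: "0 < 1 - u\<^sup>2" "0 < 1 - b\<^sup>2" "0 < 1 - v\<^sup>2" using ub by (auto simp: abs_square_less_1)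
  have s: "s \<ge> 0" using ub pos by (simp add: s_def flip: u_def b_def)
  have eq: "v\<^sup>2 * ((1 - u\<^sup>2) * (1 - b\<^sup>2)) = (norm (x - a))\<^sup>2 * (1 - v\<^sup>2)"
    using hyperbolic_isometryD(3) [OF h x a(1)] a(2) by (simp add: u_def b_def v_def)
  have "(1 + u * b)\<^sup>2 * s\<^sup>2 = (u + b)\<^sup>2"
    using pos by (simp add: s_def power_divide flip: u_def b_def)
  \<comment> \<open>For the extremal distance, this identity makes the denominator a perfect
    square.\<close>
  moreover have "(1 - u\<^sup>2) * (1 - b\<^sup>2) + (u + b)\<^sup>2 = (1 + u * b)\<^sup>2" by (simp add: power2_eq_square algebra_simps)
  moreover have "v\<^sup>2 * ((1 - u\<^sup>2) * (1 - b\<^sup>2)) + v\<^sup>2 * (u + b)\<^sup>2 \<le> (u + b)\<^sup>2"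
    if "(norm (x - a))\<^sup>2 \<le> (u + b)\<^sup>2"
    using mult_right_mono [OF that, of "1 - v\<^sup>2"] pos2 unfolding eq by (simp add: algebra_simps)
  moreover have "(norm (x - a))\<^sup>2 \<le> (u + b)\<^sup>2"
    unfolding u_def b_def by (intro power_mono norm_triangle_ineq4) auto
  ultimately have "(1 + u * b)\<^sup>2 * v\<^sup>2 \<le> (1 + u * b)\<^sup>2 * s\<^sup>2" by (metis distrib_left mult.commute)
  then have "v\<^sup>2 \<le> s\<^sup>2" using pos by simp
  then show "norm (h x) \<le> s" using s by (auto simp: v_def intro: power2_le_imp_le)
  show "norm (h x) = s" if "norm (x - a) = norm x + norm a"
  proof -
    have "v\<^sup>2 * ((1 - u\<^sup>2) * (1 - b\<^sup>2) + (u + b)\<^sup>2) = (u + b)\<^sup>2"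
      using eq that by (simp add: u_def b_def algebra_simps)
    then have "v\<^sup>2 * (1 + u * b)\<^sup>2 = s\<^sup>2 * (1 + u * b)\<^sup>2"
      using \<open>(1 - u\<^sup>2) * (1 - b\<^sup>2) + (u + b)\<^sup>2 = (1 + u * b)\<^sup>2\<close> \<open>(1 + u * b)\<^sup>2 * s\<^sup>2 = (u + b)\<^sup>2\<close>
      by (simp add: mult.commute)
    then have "v\<^sup>2 = s\<^sup>2" using pos by simp
    then show ?thesis using s ub by (simp add: v_def)
  qed
qed

subsection \<open>Quasihyperbolic distance in the ball\<close>

lemma infdist_frontier_ball:
  fixes z :: "'a::euclidean_space"
  assumes "z \<in> ball 0 1"
  shows "infdist z (frontier (ball 0 1)) = 1 - norm z"
proof -
  obtain e :: 'a where e: "norm e = 1" "z = norm z *\<^sub>R e"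
  proof (cases "z = 0")
    case True
    then show ?thesis using that vector_choose_size [of 1] by (metis norm_zero scaleR_zero_left zero_le_one)
  next
    case False
    then show ?thesis using that [of "z /\<^sub>R norm z"] by simp
  qed
  have "frontier (ball (0::'a) 1) = sphere 0 1" by simp
  moreover have "infdist z (sphere 0 1) = 1 - norm z"
  proof (rule antisym)
    have "z - e = (norm z - 1) *\<^sub>R e" using e(2) by (metis scaleR_diff_left scaleR_one)
    then have "dist z e = 1 - norm z" using e(1) assms by (simp add: dist_norm)
    then show "infdist z (sphere 0 1) \<le> 1 - norm z"
      using infdist_le [of e "sphere 0 1" z] e(1) by simp
    have "1 - norm z \<le> dist z w" if "w \<in> sphere 0 1" for w
      using norm_triangle_ineq2 [of w z] that by (simp add: dist_norm norm_minus_commute)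
    moreover have "sphere (0::'a) 1 \<noteq> {}" using e(1) by (auto intro!: exI [of _ e])
    ultimately show "1 - norm z \<le> infdist z (sphere 0 1)"
      by (simp add: infdist_notempty) (rule cINF_greatest, auto)
  qed
  ultimately show ?thesis by simp
qed

text \<open>Written with \<open>infdist\<close> so that it is literally the integrand of
  \<open>quasihyperbolic_dist\<close>; the closed form \<open>1 / (1 - norm z)\<close> is claimed
  inside the ball only.\<close>

definition ball_density :: "'a::euclidean_space \<Rightarrow> real" where
  "ball_density z = 1 / infdist z (frontier (ball 0 1))"

lemma ball_density_eq: "z \<in> ball 0 1 \<Longrightarrow> ball_density z = 1 / (1 - norm z)"
  unfolding ball_density_def by (simp only: infdist_frontier_ball)

lemma ball_density_pos: "z \<in> ball 0 1 \<Longrightarrow> 0 < ball_density z"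
  by (simp add: ball_density_eq)

lemma ball_density_continuous:
  assumes "S \<subseteq> ball 0 1"
  shows "continuous_on S ball_density"
proof -
  have "continuous_on S (\<lambda>z. 1 / (1 - norm z))" using assms by (intro continuous_intros) auto
  then show ?thesis using assms by (subst continuous_on_cong [OF refl ball_density_eq]) auto
qed

definition ball_curves :: "'a::euclidean_space \<Rightarrow> 'a \<Rightarrow> (real \<Rightarrow> 'a) set" where
  "ball_curves x y = {g. rectifiable_path g \<and> path_image g \<subseteq> ball 0 1 \<and> pathstart g = x \<and> pathfinish g = y}"

lemma quasihyperbolic_dist_ball:
  "quasihyperbolic_dist (ball 0 1) x y = Inf ((\<lambda>g. arc_length_integral g ball_density) ` ball_curves x y)"
  unfolding quasihyperbolic_dist_def ball_curves_def ball_density_def by (rule arg_cong [of _ _ Inf]) blast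

lemma arc_length_integral_nonneg:
  assumes "g \<in> ball_curves x y"
  shows "0 \<le> arc_length_integral g ball_density"
proof -
  have g: "rectifiable_path g" "path_image g \<subseteq> ball 0 1" using assms by (auto simp: ball_curves_def)
  have "0 \<le> ball_density (g u)" if "u \<in> {0..1}" for u
    using g(2) that ball_density_pos [of "g u"] by (simp add: path_image_def image_subset_iff)
  then show ?thesis
    using partial_integral_bounds(1) [OF g(1) ball_density_continuous [OF g(2)], of 0 1 0]
    by (simp add: partial_integral_1 partial_integral_0 [OF g(1)])
qed

lemma quasihyperbolic_dist_le:
  assumes "g \<in> ball_curves x y"
  shows "quasihyperbolic_dist (ball 0 1) x y \<le> arc_length_integral g ball_density"
  unfolding quasihyperbolic_dist_ball
  by (rule cINF_lower [OF _ assms]) (use arc_length_integral_nonneg in \<open>auto intro!: bdd_belowI2\<close>)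

lemma linepath_polygon_lengths:
  assumes "c \<in> polygon_lengths (linepath x y) s t"
  shows "c = (t - s) * norm (y - x)"
proof -
  obtain p m where p: "c = (\<Sum>i<m. dist (linepath x y (p i)) (linepath x y (p (Suc i))))" "mono p" "p 0 = s" "p m = t"
    using assms by (auto simp: polygon_lengths_def)
  have "dist (linepath x y (p i)) (linepath x y (p (Suc i))) = (p (Suc i) - p i) * norm (y - x)" for i
  proof -
    have "linepath x y (p (Suc i)) - linepath x y (p i) = (p (Suc i) - p i) *\<^sub>R (y - x)"
      by (simp add: linepath_def algebra_simps)
    then show ?thesis using p(2) by (simp add: dist_norm norm_minus_commute [of "linepath x y (p i)"] mono_def)
  qed
  then have "c = (\<Sum>i<m. p (Suc i) - p i) * norm (y - x)" by (simp add: p(1) sum_distrib_right)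
  then show ?thesis using p(3,4) by (simp add: sum_lessThan_telescope)
qed

lemma linepath_rectifiable: "rectifiable_path (linepath x y)"
proof -
  have "bdd_above (polygon_lengths (linepath x y) 0 1)"
    by (rule bdd_aboveI [of _ "norm (y - x)"]) (auto dest: linepath_polygon_lengths)
  then show ?thesis by (simp add: rectifiable_path_def polygon_lengths_def inscribed_lengths_def)
qed

lemma linepath_in_ball_curves:
  assumes "x \<in> ball 0 1" "y \<in> ball 0 1"
  shows "linepath x y \<in> ball_curves x y"
  using assms convex_contains_segment [of "ball (0::'a) 1"] linepath_rectifiable [of x y]
  by (auto simp: ball_curves_def)

text \<open>The segment from \<open>x\<close> to \<open>y\<close> makes the set of competing curves
  nonempty, as a lower bound for a real \<open>Inf\<close> requires.\<close>

lemma quasihyperbolic_dist_greatest: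
  assumes "x \<in> ball 0 1" "y \<in> ball 0 1"
    and "\<And>g. g \<in> ball_curves x y \<Longrightarrow> M \<le> arc_length_integral g ball_density"
  shows "M \<le> quasihyperbolic_dist (ball 0 1) x y"
  unfolding quasihyperbolic_dist_ball
  by (rule cINF_greatest) (use assms linepath_in_ball_curves [OF assms(1,2)] in auto)

text \<open>On the segment the density is largest at \<open>y\<close>. The exact distance is
  \<open>- ln (1 - norm y)\<close>; the cruder bound has the same first-order behaviour at 0, which
  is all that sharpness uses.\<close>

lemma quasihyperbolic_dist_origin_le:
  assumes "y \<in> ball 0 1"
  shows "quasihyperbolic_dist (ball 0 1) 0 y \<le> norm y / (1 - norm y)"
proof -
  have lp: "linepath 0 y \<in> ball_curves 0 y" using assms by (intro linepath_in_ball_curves) auto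
  then have im: "path_image (linepath 0 y) \<subseteq> ball 0 1" by (simp add: ball_curves_def)
  have V: "variation (linepath 0 y) 0 1 \<le> norm y"
    by (rule variation_least) (auto dest: linepath_polygon_lengths simp: linepath_rectifiable)
  have "arc_length_integral (linepath 0 y) ball_density \<le> 1 / (1 - norm y) * variation (linepath 0 y) 0 1"
  proof -
    have "ball_density (linepath 0 y u) \<le> 1 / (1 - norm y)" if u: "u \<in> {0..1}" for u
    proof -
      have eq: "linepath 0 y u = u *\<^sub>R y" by (simp add: linepath_def)
      have le: "norm (u *\<^sub>R y) \<le> norm y" using u by (simp add: mult_left_le_one_le)
      then show ?thesis unfolding eq using assms by (subst ball_density_eq) (auto intro!: divide_left_mono mult_pos_pos)
    qed
    then show ?thesis
      using partial_integral_bounds(2) [OF linepath_rectifiable ball_density_continuous [OF im], of 0 1 "1 / (1 - norm y)"]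
      by (simp add: partial_integral_1 partial_integral_0 [OF linepath_rectifiable])
  qed
  also have "\<dots> \<le> 1 / (1 - norm y) * norm y" using V assms by (intro mult_left_mono) auto
  finally show ?thesis using quasihyperbolic_dist_le [OF lp] by simp
qed

lemma tendsto_ball_density:
  assumes "g \<in> ball_curves x y" "t \<in> {0..1}"
  shows "((\<lambda>t. ball_density (g t)) \<longlongrightarrow> ball_density (g t)) (at t within {0..1})"
proof -
  have "continuous_on {0..1} (\<lambda>t. ball_density (g t))"
    using assms by (intro continuous_on_compose2 [OF ball_density_continuous [OF order_refl]])
      (auto simp: ball_curves_def rectifiable_path_def path_def path_image_def)
  then show ?thesis using assms(2) by (simp add: continuous_on)
qed

lemma eventually_within_interval:
  fixes x :: real
  assumes "\<forall>\<^sub>F t in at x within {0..1}. P t" "P x"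
  obtains d where "d > 0" "\<And>t. \<lbrakk>t \<in> {0..1}; \<bar>t - x\<bar> < d\<rbrakk> \<Longrightarrow> P t"
proof -
  obtain d where "d > 0" "\<And>t. \<lbrakk>t \<in> {0..1}; t \<noteq> x; dist t x < d\<rbrakk> \<Longrightarrow> P t"
    using assms(1) unfolding eventually_at by auto
  then show ?thesis using assms(2) that [of d] by (metis dist_real_def)
qed

text \<open>Along a curve, \<open>- ln (1 - norm z)\<close> grows no faster than the integral of the
  density, because it is a primitive of the density in the radial variable and the norm is
  1-Lipschitz.\<close>

lemma quasihyperbolic_dist_ge_ln:
  assumes "x \<in> ball 0 1" "y \<in> ball 0 1"
  shows "ln ((1 - norm x) / (1 - norm y)) \<le> quasihyperbolic_dist (ball 0 1) x y"
proof (rule quasihyperbolic_dist_greatest [OF assms])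
  fix g assume gb: "g \<in> ball_curves x y"
  then have g: "rectifiable_path g" "path_image g \<subseteq> ball 0 1" "g 0 = x" "g 1 = y"
    by (auto simp: ball_curves_def pathstart_def pathfinish_def)
  define A where "A t = - ln (1 - norm (g t))" for t
  have gt: "norm (g t) < 1" if "t \<in> {0..1}" for t using g(2) that by (simp add: path_image_def image_subset_iff)
  have "A 1 - A 0 \<le> 1 * arc_length_integral g ball_density"
  proof (rule increment_le_arc_length_integral [OF g(1) ball_density_continuous [OF g(2)]])
    fix t0 K assume t0: "t0 \<in> {0..1::real}" "1 * ball_density (g t0) < K"
    have "\<forall>\<^sub>F t in at t0 within {0..1}. ball_density (g t) < K"
      using order_tendstoD(2) [OF tendsto_ball_density [OF gb t0(1)]] t0(2) by simp
    then obtain d where d: "d > 0" "\<And>t. \<lbrakk>t \<in> {0..1}; \<bar>t - t0\<bar> < d\<rbrakk> \<Longrightarrow> ball_density (g t) < K"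
      using eventually_within_interval t0(2) by (metis (no_types, lifting) mult_1)
    have "A t - A s \<le> K * variation g s t" if st: "0 \<le> s" "s \<le> t0" "t0 \<le> t" "t \<le> 1" "t - s < d" for s t
    proof -
      have n: "norm (g s) < 1" "norm (g t) < 1" using gt st by auto
      have "A t - A s = ln ((1 - norm (g s)) / (1 - norm (g t)))" using n by (simp add: A_def ln_div)
      \<comment> \<open>The inequality \<open>ln r \<le> r - 1\<close> bounds the increment by the
        density at the endpoint \<open>g t\<close>, which is below \<open>K\<close> near
        \<open>t0\<close>.\<close>
      also have "\<dots> \<le> (1 - norm (g s)) / (1 - norm (g t)) - 1" using n by (intro ln_le_minus_one) simp
      also have "\<dots> = ball_density (g t) * (norm (g t) - norm (g s))"
        using n by (simp add: ball_density_eq field_simps)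
      also have "\<dots> \<le> ball_density (g t) * variation g s t"
      proof (rule mult_left_mono)
        have "norm (g t) - norm (g s) \<le> dist (g s) (g t)"
          by (metis dist_norm norm_minus_commute norm_triangle_ineq2)
        then show "norm (g t) - norm (g s) \<le> variation g s t"
          using dist_le_variation [OF g(1), of s t] st by linarith
        show "0 \<le> ball_density (g t)" using ball_density_pos [of "g t"] n by simp
      qed
      also have "\<dots> \<le> K * variation g s t"
        using d(2)[of t] variation_nonneg [OF g(1), of s t] st by (intro mult_right_mono) auto
      finally show ?thesis .
    qed
    then show "\<exists>d>0. \<forall>s t. 0 \<le> s \<and> s \<le> t0 \<and> t0 \<le> t \<and> t \<le> 1 \<and> t - s < d \<longrightarrow> A t - A s \<le> K * variation g s t"
      using d(1) by blast
  qed (use g(2) ball_density_pos in \<open>auto simp: subset_iff simp del: mem_ball_0 mem_ball\<close>)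
  moreover have "A 1 - A 0 = ln ((1 - norm x) / (1 - norm y))"
    using assms by (simp add: A_def g ln_div)
  ultimately show "ln ((1 - norm x) / (1 - norm y)) \<le> arc_length_integral g ball_density" by simp
qed

section \<open>Images of curves and the upper estimate\<close>

definition dilation :: "('a::euclidean_space \<Rightarrow> 'a) \<Rightarrow> 'a \<Rightarrow> real" where
  "dilation h z = (1 - (norm (h z))\<^sup>2) / (1 - (norm z)\<^sup>2)"

lemma hyperbolic_isometry_dilation:
  assumes h: "hyperbolic_isometry h"
  shows "conformal_factor h (dilation h)"
  unfolding conformal_factor_def
proof (intro conjI ballI)
  fix x y :: 'a assume xy: "x \<in> ball 0 1" "y \<in> ball 0 1"
  have "1 - (norm x)\<^sup>2 \<noteq> 0" "1 - (norm y)\<^sup>2 \<noteq> 0"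
    using one_minus_norm_sq_pos xy by (metis less_irrefl)+
  then show "(norm (h x - h y))\<^sup>2 = dilation h x * dilation h y * (norm (x - y))\<^sup>2"
    using hyperbolic_isometryD(3) [OF h xy]
    by (simp add: dilation_def nonzero_eq_divide_eq mult.commute [of "(norm (x - y))\<^sup>2"])
next
  fix x :: 'a assume x: "x \<in> ball 0 1"
  then have "h x \<in> ball 0 1" using hyperbolic_isometryD(2) [OF h] by simp
  then show "0 < dilation h x"
    unfolding dilation_def by (intro divide_pos_pos one_minus_norm_sq_pos x)
qed

lemma hyperbolic_isometry_continuous:
  assumes h: "hyperbolic_isometry h"
  shows "continuous_on (ball 0 1) h"
  using conformal_factor_continuous [OF _ hyperbolic_isometry_dilation [OF h]] hyperbolic_isometryD(1) [OF h]
  by (simp add: bij_betw_def)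

lemma dilation_continuous:
  assumes h: "hyperbolic_isometry h"
  shows "continuous_on (ball 0 1) (dilation h)"
proof -
  have "\<forall>z\<in>ball (0::'a) 1. 1 - (norm z)\<^sup>2 \<noteq> 0" by (metis one_minus_norm_sq_pos less_irrefl)
  then show ?thesis unfolding dilation_def by (intro continuous_intros hyperbolic_isometry_continuous [OF h])
qed

text \<open>The distance ratio is exactly the geometric mean of the two dilations, so bounds at the
  two endpoints suffice.\<close>

lemma hyperbolic_isometry_lipschitz:
  assumes h: "hyperbolic_isometry h" and xy: "x \<in> ball 0 1" "y \<in> ball 0 1"
    and L: "dilation h x \<le> L" "dilation h y \<le> L"
  shows "dist (h x) (h y) \<le> L * dist x y"
proof (rule power2_le_imp_le)
  note c = conformal_factorD [OF hyperbolic_isometry_dilation [OF h]]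
  have L0: "0 < dilation h x" "0 < dilation h y" using c(1) xy by auto
  have "dilation h x * dilation h y * (norm (x - y))\<^sup>2 \<le> L * L * (norm (x - y))\<^sup>2"
    using L L0 by (intro mult_right_mono mult_mono) auto
  then show "(dist (h x) (h y))\<^sup>2 \<le> (L * dist x y)\<^sup>2"
    unfolding dist_norm power_mult_distrib c(2) [OF xy] by (simp add: power2_eq_square)
  show "0 \<le> L * dist x y" using L L0 by simp
qed

text \<open>The dilation attains a maximum on the compact image of the curve, so \<open>h\<close> is
  Lipschitz there and lengths of inscribed polygons stay bounded.\<close>

lemma hyperbolic_isometry_ball_curves:
  assumes h: "hyperbolic_isometry h" and gb: "g \<in> ball_curves x y"
  shows "h \<circ> g \<in> ball_curves (h x) (h y)"
proof -
  have g: "rectifiable_path g" "path g" "path_image g \<subseteq> ball 0 1" "g 0 = x" "g 1 = y"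
    using gb by (auto simp: ball_curves_def pathstart_def pathfinish_def rectifiable_path_def)
  have gt: "g t \<in> ball 0 1" if "t \<in> {0..1}" for t using g(3) that by (simp add: path_image_def image_subset_iff)
  have "compact (path_image g)" "path_image g \<noteq> {}" using g(2) by auto
  then obtain w where "w \<in> path_image g" "\<And>z. z \<in> path_image g \<Longrightarrow> dilation h z \<le> dilation h w"
    using continuous_attains_sup [of "path_image g" "dilation h"]
      continuous_on_subset [OF dilation_continuous [OF h] g(3)] by metis
  then have Lip: "dist ((h \<circ> g) u) ((h \<circ> g) v) \<le> dilation h w * dist (g u) (g v)" if "u \<in> {0..1}" "v \<in> {0..1}" for u v
    using hyperbolic_isometry_lipschitz [OF h gt gt] that by (simp add: path_image_def)
  have w0: "0 \<le> dilation h w"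
    using conformal_factorD(1) [OF hyperbolic_isometry_dilation [OF h]] g(3) \<open>w \<in> path_image g\<close>
    by (meson less_imp_le subsetD)
  have "bdd_above (polygon_lengths (h \<circ> g) 0 1)"
  proof (rule bdd_aboveI)
    fix c assume "c \<in> polygon_lengths (h \<circ> g) 0 1"
    then obtain b where b: "b \<in> polygon_lengths g 0 1" "c \<le> dilation h w * b"
    proof (rule polygon_lengths_lipschitz)
      show "dist ((h \<circ> g) u) ((h \<circ> g) v) \<le> dilation h w * dist (g u) (g v)" if "u \<in> {0..1}" "v \<in> {0..1}" for u v
        using that by (rule Lip)
    qed
    then show "c \<le> dilation h w * variation g 0 1"
      using mult_left_mono [OF variation_upper [OF g(1) _ _ _ b(1)] w0] by simp
  qed
  moreover have "path (h \<circ> g)"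
    using g(2,3) continuous_on_subset [OF hyperbolic_isometry_continuous [OF h] g(3)] by (intro path_continuous_image)
  moreover have "path_image (h \<circ> g) \<subseteq> ball 0 1"
    using gt hyperbolic_isometryD(2) [OF h] by (auto simp: path_image_def)
  ultimately show ?thesis
    using g by (auto simp: ball_curves_def rectifiable_path_def polygon_lengths_def inscribed_lengths_def
      pathstart_def pathfinish_def)
qed

lemma dilation_density_le:
  assumes h: "hyperbolic_isometry h" and a: "a \<in> ball 0 1" "h a = 0" and z: "z \<in> ball 0 1"
  shows "dilation h z * ball_density (h z) \<le> (1 + norm a) * ball_density z"
proof -
  define u b v where "u = norm z" and "b = norm a" and "v = norm (h z)"
  have r: "0 \<le> u" "u < 1" "0 \<le> b" "b < 1" "0 \<le> v" "v < 1"
    using z a(1) hyperbolic_isometryD(2) [OF h z] by (auto simp: u_def b_def v_def)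
  have "v \<le> (u + b) / (1 + u * b)"
    using hyperbolic_isometry_norm(1) [OF h a z] by (simp add: u_def b_def v_def)
  \<comment> \<open>The coarser bound \<open>v \<le> u + b\<close> suffices, since
    \<open>(1 + b) (1 + u)\<close> exceeds \<open>1 + u + b\<close> by \<open>u b\<close>. The
    factor \<open>1 - v\<close> cancels between the dilation and the density at
    \<open>h z\<close>.\<close>
  also have "\<dots> \<le> (u + b) / 1" using r by (intro divide_left_mono) (auto simp: add_pos_nonneg)
  finally have "1 + v \<le> (1 + b) * (1 + u)" using mult_nonneg_nonneg [OF r(1,3)] by (simp add: algebra_simps)
  moreover have "dilation h z * ball_density (h z) = (1 + v) / ((1 + u) * (1 - u))"
  proof -
    have "ball_density (h z) = 1 / (1 - v)" using ball_density_eq [of "h z"] r by (simp add: v_def)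
    moreover have "dilation h z = ((1 + v) * (1 - v)) / ((1 + u) * (1 - u))"
      unfolding dilation_def u_def [symmetric] v_def [symmetric] by (simp add: power2_eq_square algebra_simps)
    ultimately show ?thesis using r by simp
  qed
  moreover have "(1 + v) / ((1 + u) * (1 - u)) \<le> ((1 + b) * (1 + u)) / ((1 + u) * (1 - u))"
    if "1 + v \<le> (1 + b) * (1 + u)"
    using that r by (intro divide_right_mono) auto
  moreover have "((1 + b) * (1 + u)) / ((1 + u) * (1 - u)) = (1 + b) * ball_density z"
    using ball_density_eq [OF z] r by (simp flip: u_def)
  ultimately show ?thesis by (simp add: b_def)
qed

text \<open>The comparison principle is applied to the partial integrals of the image curve. Near
  \<open>t0\<close> these grow at most by the image density times the dilation times the length of
  \<open>g\<close>.\<close>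

lemma arc_length_integral_hyperbolic_isometry:
  assumes h: "hyperbolic_isometry h" and a: "a \<in> ball 0 1" "h a = 0" and gb: "g \<in> ball_curves x y"
  shows "arc_length_integral (h \<circ> g) ball_density \<le> (1 + norm a) * arc_length_integral g ball_density"
proof -
  note fb = hyperbolic_isometry_ball_curves [OF h gb]
  have g: "rectifiable_path g" "path_image g \<subseteq> ball 0 1" and f: "rectifiable_path (h \<circ> g)" "path_image (h \<circ> g) \<subseteq> ball 0 1"
    using gb fb by (auto simp: ball_curves_def)
  have gt: "g t \<in> ball 0 1" if "t \<in> {0..1}" for t using g(2) that by (simp add: path_image_def image_subset_iff)
  note fc = ball_density_continuous [OF f(2)]
  define A where "A = partial_integral (h \<circ> g) ball_density"
  have "A 1 - A 0 \<le> (1 + norm a) * arc_length_integral g ball_density"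
  proof (rule increment_le_arc_length_integral [OF g(1) ball_density_continuous [OF g(2)]])
    fix t0 K assume t0: "t0 \<in> {0..1::real}" "(1 + norm a) * ball_density (g t0) < K"
    define p q where "p = dilation h (g t0)" and "q = ball_density (h (g t0))"
    have q0: "q > 0" using ball_density_pos [of "h (g t0)"] hyperbolic_isometryD(2) [OF h gt [OF t0(1)]] by (simp add: q_def)
    have p0: "p > 0" using conformal_factorD(1) [OF hyperbolic_isometry_dilation [OF h] gt [OF t0(1)]] by (simp add: p_def)
    have pq: "p * q < K" using dilation_density_le [OF h a gt [OF t0(1)]] t0(2) by (simp add: p_def q_def)
    \<comment> \<open>As \<open>p * q < K\<close> is strict, some \<open>e > 0\<close> can be added
      to both factors; this is the tolerance for the variation of dilation and density near
      \<open>t0\<close>.\<close>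
    have "((\<lambda>e. (p + e) * (q + e)) \<longlongrightarrow> (p + 0) * (q + 0)) (at_right 0)" by (intro tendsto_intros)
    then have "\<forall>\<^sub>F e in at_right 0. (p + e) * (q + e) < K" using pq by (intro order_tendstoD) auto
    then have "\<forall>\<^sub>F e in at_right 0. (p + e) * (q + e) < K \<and> e > 0"
      using eventually_at_right_less by (rule eventually_conj)
    then obtain e where e: "e > 0" "(p + e) * (q + e) < K"
      using eventually_happens' [OF trivial_limit_at_right_real] by blast
    have "continuous_on {0..1} (\<lambda>t. dilation h (g t))"
      using g by (intro continuous_on_compose2 [OF dilation_continuous [OF h]])
        (auto simp: rectifiable_path_def path_def path_image_def)
    then have "((\<lambda>t. dilation h (g t)) \<longlongrightarrow> p) (at t0 within {0..1})" using t0(1) by (simp add: continuous_on p_def)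
    then have "\<forall>\<^sub>F t in at t0 within {0..1}. dilation h (g t) < p + e" by (rule order_tendstoD) (use e in simp)
    moreover have "\<forall>\<^sub>F t in at t0 within {0..1}. ball_density ((h \<circ> g) t) < q + e"
      using tendsto_ball_density [OF fb t0(1)] by (rule order_tendstoD) (use e in \<open>simp add: q_def\<close>)
    ultimately have "\<forall>\<^sub>F t in at t0 within {0..1}. dilation h (g t) < p + e \<and> ball_density ((h \<circ> g) t) < q + e"
      by (rule eventually_conj)
    then obtain d where d: "d > 0" "\<And>t. \<lbrakk>t \<in> {0..1}; \<bar>t - t0\<bar> < d\<rbrakk> \<Longrightarrow> dilation h (g t) < p + e \<and> ball_density ((h \<circ> g) t) < q + e"
      using e by (elim eventually_within_interval) (auto simp: p_def q_def)
    have "A t - A s \<le> K * variation g s t" if st: "0 \<le> s" "s \<le> t0" "t0 \<le> t" "t \<le> 1" "t - s < d" for s t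
    proof -
      have near: "u \<in> {0..1}" "dilation h (g u) \<le> p + e" "ball_density ((h \<circ> g) u) \<le> q + e" if "u \<in> {s..t}" for u
      proof -
        show u: "u \<in> {0..1}" using that st by auto
        have "\<bar>u - t0\<bar> < d" using that st by auto
        from d(2) [OF u this] show "dilation h (g u) \<le> p + e" "ball_density ((h \<circ> g) u) \<le> q + e" by auto
      qed
      have s: "s \<le> t" using st by simp
      have "variation (h \<circ> g) s t \<le> (p + e) * variation g s t"
      proof (rule variation_least [OF f(1) s])
        fix c assume "c \<in> polygon_lengths (h \<circ> g) s t"
        then obtain b where b: "b \<in> polygon_lengths g s t" "c \<le> (p + e) * b"
        proof (rule polygon_lengths_lipschitz)
          fix u v assume "u \<in> {s..t}" "v \<in> {s..t}"
          then show "dist ((h \<circ> g) u) ((h \<circ> g) v) \<le> (p + e) * dist (g u) (g v)"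
            using hyperbolic_isometry_lipschitz [OF h gt gt] near by simp
        qed
        then show "c \<le> (p + e) * variation g s t"
          using p0 e by (intro order_trans [OF b(2)] mult_left_mono variation_upper [OF g(1) st(1) s st(4)]) auto
      qed
      then have "(q + e) * variation (h \<circ> g) s t \<le> (q + e) * ((p + e) * variation g s t)"
        using q0 e by (intro mult_left_mono) auto
      also have "\<dots> = ((p + e) * (q + e)) * variation g s t" by simp
      also have "\<dots> \<le> K * variation g s t"
        using e variation_nonneg [OF g(1) st(1) s st(4)] by (intro mult_right_mono) auto
      finally have "(q + e) * variation (h \<circ> g) s t \<le> K * variation g s t" .
      moreover have "A t - A s \<le> (q + e) * variation (h \<circ> g) s t"
        unfolding A_def by (rule partial_integral_bounds(2) [OF f(1) fc st(1) s st(4)]) (rule near)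
      ultimately show ?thesis by linarith
    qed
    then show "\<exists>d>0. \<forall>s t. 0 \<le> s \<and> s \<le> t0 \<and> t0 \<le> t \<and> t \<le> 1 \<and> t - s < d \<longrightarrow> A t - A s \<le> K * variation g s t"
      using d(1) by blast
  qed (use g(2) ball_density_pos in \<open>auto simp: subset_iff simp del: mem_ball_0 mem_ball\<close>)
  moreover have "A 1 = arc_length_integral (h \<circ> g) ball_density" "A 0 = 0"
    by (simp_all add: A_def partial_integral_1 partial_integral_0 [OF f(1)])
  ultimately show ?thesis by simp
qed

lemma quasihyperbolic_dist_hyperbolic_isometry:
  assumes h: "hyperbolic_isometry h" and a: "a \<in> ball 0 1" "h a = 0" and xy: "x \<in> ball 0 1" "y \<in> ball 0 1"
  shows "quasihyperbolic_dist (ball 0 1) (h x) (h y) \<le> (1 + norm a) * quasihyperbolic_dist (ball 0 1) x y"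
proof -
  have pos: "0 < 1 + norm a" by (simp add: add_pos_nonneg)
  have "quasihyperbolic_dist (ball 0 1) (h x) (h y) / (1 + norm a) \<le> quasihyperbolic_dist (ball 0 1) x y"
  proof (rule quasihyperbolic_dist_greatest [OF xy])
    fix g assume g: "g \<in> ball_curves x y"
    have "quasihyperbolic_dist (ball 0 1) (h x) (h y) \<le> arc_length_integral (h \<circ> g) ball_density"
      by (rule quasihyperbolic_dist_le [OF hyperbolic_isometry_ball_curves [OF h g]])
    also have "\<dots> \<le> (1 + norm a) * arc_length_integral g ball_density"
      by (rule arc_length_integral_hyperbolic_isometry [OF h a g])
    finally show "quasihyperbolic_dist (ball 0 1) (h x) (h y) / (1 + norm a) \<le> arc_length_integral g ball_density"
      by (simp add: pos_divide_le_eq [OF pos] mult.commute)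
  qed
  then show ?thesis by (simp add: pos_divide_le_eq [OF pos] mult.commute)
qed

section \<open>Sharpness of the constants\<close>

text \<open>The test points are \<open>t *\<^sub>R e\<close> with \<open>e\<close> opposite to
  \<open>a\<close>, where the norm bound for \<open>h\<close> is an equality. The lower bound for
  the image distance and the upper bound for the distance to 0 share a factor \<open>t\<close>;
  after cancelling it, \<open>t\<close> tends to 0.\<close>

lemma quasihyperbolic_lipschitz_constant_ge:
  fixes h :: "'a::euclidean_space \<Rightarrow> 'a"
  assumes h: "hyperbolic_isometry h" and a: "a \<in> ball 0 1" "h a = 0"
    and c: "\<And>y. y \<in> ball 0 1 \<Longrightarrow> quasihyperbolic_dist (ball 0 1) (h 0) (h y) \<le> c * quasihyperbolic_dist (ball 0 1) 0 y"
  shows "1 + norm a \<le> c"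
proof -
  define b where "b = norm a"
  have b: "0 \<le> b" "b < 1" using a(1) by (auto simp: b_def)
  obtain e :: 'a where e: "norm e = 1" "a = - (b *\<^sub>R e)"
  proof (cases "a = 0")
    case True
    then show ?thesis using that vector_choose_size [of 1] by (auto simp: b_def)
  next
    case False
    then show ?thesis using that [of "- (a /\<^sub>R norm a)"] by (simp add: b_def)
  qed
  have main: "(1 + b) * (1 - t) \<le> c * (1 + t * b)" if t: "0 < t" "t < 1" for t
  proof -
    define y where "y = t *\<^sub>R e"
    have y: "y \<in> ball 0 1" "norm y = t" using e t by (auto simp: y_def)
    have "y - a = (t + b) *\<^sub>R e" using e(2) by (simp add: y_def scaleR_add_left)
    then have "norm (y - a) = norm y + norm a" using e(1) t b y by (simp add: b_def)
    then have hy: "norm (h y) = (t + b) / (1 + t * b)"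
      using hyperbolic_isometry_norm(2) [OF h a y(1)] y(2) by (simp add: b_def)
    have h0: "norm (h 0) = b" using hyperbolic_isometry_center [OF h a] by (simp add: b_def)
    have pos: "0 < 1 + t * b" using t b by (simp add: add_pos_nonneg)
    have "1 - norm (h y) = (1 - b) * (1 - t) / (1 + t * b)" using pos by (simp add: hy field_simps)
    then have q: "(1 - norm (h 0)) / (1 - norm (h y)) = (1 + t * b) / (1 - t)"
      using b t pos by (simp add: h0)
    \<comment> \<open>This rewriting prepares \<open>1 - r \<le> - ln r\<close>, which turns the
      logarithmic bound into a rational one.\<close>
    have "t * (1 + b) / (1 + t * b) = 1 - (1 - t) / (1 + t * b)" using pos by (simp add: field_simps)
    also have "\<dots> \<le> - ln ((1 - t) / (1 + t * b))"
      using ln_le_minus_one [of "(1 - t) / (1 + t * b)"] pos t by simp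
    also have "\<dots> = ln ((1 - norm (h 0)) / (1 - norm (h y)))" unfolding q using pos t by (simp add: ln_div)
    also have "\<dots> \<le> quasihyperbolic_dist (ball 0 1) (h 0) (h y)"
      using hyperbolic_isometryD(2) [OF h] y by (intro quasihyperbolic_dist_ge_ln) auto
    also have "\<dots> \<le> c * quasihyperbolic_dist (ball 0 1) 0 y" using c [OF y(1)] .
    finally have 1: "t * (1 + b) / (1 + t * b) \<le> c * quasihyperbolic_dist (ball 0 1) 0 y" .
    have k0: "0 \<le> quasihyperbolic_dist (ball 0 1) 0 y"
      using y(1) arc_length_integral_nonneg by (intro quasihyperbolic_dist_greatest) auto
    \<comment> \<open>The sign of \<open>c\<close> must be known before the upper bound for the
      distance is multiplied by it.\<close>
    have "0 < t * (1 + b) / (1 + t * b)" using t b pos by simp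
    then have "0 < c * quasihyperbolic_dist (ball 0 1) 0 y" using 1 by linarith
    then have "c > 0" using k0 by (simp add: zero_less_mult_iff)
    then have "c * quasihyperbolic_dist (ball 0 1) 0 y \<le> c * (t / (1 - t))"
      using mult_left_mono [OF quasihyperbolic_dist_origin_le [OF y(1)], of c] unfolding y(2) by linarith
    then have "t * (1 + b) / (1 + t * b) \<le> c * (t / (1 - t))" using 1 by linarith
    then have "t * ((1 + b) * (1 - t)) \<le> t * (c * (1 + t * b))" using pos t by (simp add: field_simps)
    then show ?thesis using t by simp
  qed
  have ev: "\<forall>\<^sub>F t in at_right (0::real). 0 < t \<and> t < 1" by (auto intro!: eventually_at_rightI [of 0 1])
  have l: "((\<lambda>t. (1 + b) * (1 - t)) \<longlongrightarrow> (1 + b) * (1 - 0)) (at_right 0)"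
    "((\<lambda>t. c * (1 + t * b)) \<longlongrightarrow> c * (1 + 0 * b)) (at_right 0)"
    by (intro tendsto_intros)+
  have "(1 + b) * (1 - 0) \<le> c * (1 + 0 * b)"
    by (rule tendsto_le [OF trivial_limit_at_right_real l(2) l(1) eventually_mono [OF ev]]) (use main in simp)
  then show ?thesis by (simp add: b_def)
qed

theorem theorem1p4:
  fixes a :: "real ^ 'n" and h :: "real ^ 'n \<Rightarrow> real ^ 'n"
  assumes "CARD('n) \<ge> 2"
    and "a \<in> ball 0 1"
    and "moebius_self_map (ball 0 1) h"
    and "h a = 0"
  shows "(\<forall>x\<in>ball 0 1. \<forall>y\<in>ball 0 1.
           1 / (1 + norm a) * quasihyperbolic_dist (ball 0 1) x y
             \<le> quasihyperbolic_dist (ball 0 1) (h x) (h y) \<and>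
           quasihyperbolic_dist (ball 0 1) (h x) (h y)
             \<le> (1 + norm a) * quasihyperbolic_dist (ball 0 1) x y) \<and>
         (\<forall>c::real.
           (\<forall>x\<in>ball 0 1. \<forall>y\<in>ball 0 1.
              quasihyperbolic_dist (ball 0 1) (h x) (h y)
                \<le> c * quasihyperbolic_dist (ball 0 1) x y)
           \<longrightarrow> 1 + norm a \<le> c) \<and>
         (\<forall>c::real.
           (\<forall>x\<in>ball 0 1. \<forall>y\<in>ball 0 1.
              c * quasihyperbolic_dist (ball 0 1) x y
                \<le> quasihyperbolic_dist (ball 0 1) (h x) (h y))
           \<longrightarrow> c \<le> 1 / (1 + norm a))"
proof -
  let ?k = "quasihyperbolic_dist (ball (0::real ^ 'n) 1)"
  have h: "hyperbolic_isometry h" by (rule moebius_self_map_hyperbolic_isometry [OF assms(3)])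
  define f where "f = inv_into (ball 0 1) h"
  have f: "hyperbolic_isometry f" unfolding f_def by (rule hyperbolic_isometry_inv [OF h])
  have fh: "f (h x) = x" if "x \<in> ball 0 1" for x
    unfolding f_def by (rule bij_betw_inv_into_left [OF hyperbolic_isometryD(1) [OF h] that])
  have hf: "h (f x) = x" "f x \<in> ball 0 1" if "x \<in> ball 0 1" for x
    using bij_betw_inv_into_right [OF hyperbolic_isometryD(1) [OF h] that] hyperbolic_isometryD(2) [OF f that]
    by (simp_all add: f_def)
  have h0: "h 0 \<in> ball 0 1" "f (h 0) = 0" "norm (h 0) = norm a"
    using hyperbolic_isometryD(2) [OF h, of 0] fh [of 0] hyperbolic_isometry_center [OF h assms(2,4)] by auto
  have pos: "0 < 1 + norm a" by (simp add: add_pos_nonneg)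
  show ?thesis
  proof (intro conjI ballI allI impI)
    fix x y :: "real ^ 'n" assume xy: "x \<in> ball 0 1" "y \<in> ball 0 1"
    show "?k (h x) (h y) \<le> (1 + norm a) * ?k x y"
      by (rule quasihyperbolic_dist_hyperbolic_isometry [OF h assms(2,4) xy])
    \<comment> \<open>The upper estimate for the inverse \<open>f\<close>, whose zero is
      \<open>h 0\<close>; the constant is the same because
      \<open>norm (h 0) = norm a\<close>.\<close>
    have "?k (f (h x)) (f (h y)) \<le> (1 + norm (h 0)) * ?k (h x) (h y)"
      using hyperbolic_isometryD(2) [OF h] xy by (intro quasihyperbolic_dist_hyperbolic_isometry [OF f h0(1,2)]) auto
    then show "1 / (1 + norm a) * ?k x y \<le> ?k (h x) (h y)"
      using pos fh xy h0(3) by (simp add: field_simps)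
  next
    fix c :: real
    assume "\<forall>x\<in>ball 0 1. \<forall>y\<in>ball 0 1. ?k (h x) (h y) \<le> c * ?k x y"
    then show "1 + norm a \<le> c"
      by (intro quasihyperbolic_lipschitz_constant_ge [OF h assms(2,4)]) auto
  next
    fix c :: real
    assume c: "\<forall>x\<in>ball 0 1. \<forall>y\<in>ball 0 1. c * ?k x y \<le> ?k (h x) (h y)"
    show "c \<le> 1 / (1 + norm a)"
    proof (cases "c > 0")
      case True
      \<comment> \<open>A lower constant \<open>c > 0\<close> for \<open>h\<close> is an upper
        constant \<open>1 / c\<close> for \<open>f\<close>, so sharpness for \<open>f\<close>
        applies.\<close>
      have "1 + norm (h 0) \<le> 1 / c"
      proof (rule quasihyperbolic_lipschitz_constant_ge [OF f h0(1,2)])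
        fix y :: "real ^ 'n" assume y: "y \<in> ball 0 1"
        have 0: "(0::real ^ 'n) \<in> ball 0 1" by simp
        have "c * ?k (f 0) (f y) \<le> ?k (h (f 0)) (h (f y))" using c hf(2) [OF 0] hf(2) [OF y] by blast
        then have "c * ?k (f 0) (f y) \<le> ?k 0 y" unfolding hf(1) [OF 0] hf(1) [OF y] .
        then show "?k (f 0) (f y) \<le> 1 / c * ?k 0 y" using True by (simp add: field_simps)
      qed
      then show ?thesis using True pos h0(3) by (simp add: field_simps)
    next
      case False
      then have "c \<le> 0" by simp
      also have "0 \<le> 1 / (1 + norm a)" using pos by simp
      finally show ?thesis .
    qed
  qed
qed

end
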